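(* Let $n>d$, let $\mathcal{F}\in\mathbf{F}(n,d)$, $m=2d-n$, $\lambda=\lambda(S_{\mathcal{F}}^{-1})$, and let $t\ge\operatorname{tr}S_{\mathcal{F}}^{-1}$. Let $f:[0,\infty)\to[0,\infty)$ be an increasing and strictly convex function. \begin{enumerate} \item If $\mathcal{G}\in\mathcal{D}_t(\mathcal{F})$ is a global minimum of $P_f$ in $\mathcal{D}_t(\mathcal{F})$, then there exists an orthonormal basis $\{h_i\}_{i=1}^d$ of eigenvectors for $S_{\mathcal{F}}^{-1},\lambda$ such that $$S_{\mathcal{G}}=S_{\mathcal{F}}^{-1}+\sum_{i=1}^{d-r'}\big(c_{\lambda,m}(t)-\lambda_{r'+i}\big)\,h_{r'+i}\otimes h_{r'+i},$$ where $r'=\max\{r_{\lambda,m}(t),m\}$. \item If we further assume one of the conditions: $m\le0$; or $m\ge1$ and $\lambda_m>\lambda_{m+1}$; or $m\ge1$, $\lambda_m=\lambda_{m+1}$ and $t\le s^*(\lambda,m)$; then there exists a unique $S_t\in\mathcal{SD}_t(\mathcal{F})$ such that if $\mathcal{G}$ is a global minimum of $P_f$ in $\mathcal{D}_t(\mathcal{F})$ then $S_{\mathcal{G}}=S_t$. \end{enumerate}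
   Context: $\mathcal{H}\cong\mathbb{C}^d$. For $\mathcal{F}=\{f_i\}_{i=1}^n\in\mathcal{H}^n$ the analysis operator is $T_{\mathcal{F}}:\mathcal{H}\to\mathbb{C}^n$, $T_{\mathcal{F}}x=(\langle x,f_i\rangle)_i$, and the frame operator is $S_{\mathcal{F}}=T_{\mathcal{F}}^*T_{\mathcal{F}}$. $\mathbf{F}(n,d)$ is the set of $(n,d)$-frames, i.e. sequences of $n$ vectors spanning $\mathcal{H}$ (so $S_{\mathcal{F}}$ is invertible). $\mathcal{D}_t(\mathcal{F})=\{\mathcal{G}\in\mathbf{F}(n,d):T_{\mathcal{G}}^*T_{\mathcal{F}}=I,\ \operatorname{tr}S_{\mathcal{G}}\ge t\}$ and $\mathcal{SD}_t(\mathcal{F})=\{S_{\mathcal{G}}:\mathcal{G}\in\mathcal{D}_t(\mathcal{F})\}$. $\lambda(S)$ is the vector of eigenvalues of $S$ counted with multiplicity in decreasing order. $P_f(\mathcal{G})=\operatorname{tr}(f(S_{\mathcal{G}}))$. $(x\otimes y)z=\langle z,y\rangle x$. An "orthonormal basis of eigenvectors for $S,\lambda$" (with $\lambda=\lambda(S)$) is an orthonormal basis $\{h_i\}_{i=1}^d$ with $Sh_i=\lambda_ih_i$ for all $i$. Let $\lambda\in\mathbb{R}^d$ have nonnegative decreasing entries, $t_0=\sum_i\lambda_i$. For $t\ge t_0$ and $q\in\{0,\dots,d-1\}$ let $p_\lambda(q,t)=\frac{t-\sum_{j=1}^q\lambda_j}{d-q}$, and $$r_\lambda(t)=\min\{q\in\{0,\dots,d-1\}:p_\lambda(q,t)\ge\lambda_{q+1}\},\qquad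 c_\lambda(t)=p_\lambda(r_\lambda(t),t).$$ For $1\le m\le d-1$ let $s^*=s^*(\lambda,m)=\sum_{i=1}^m\lambda_i+(d-m)\lambda_m$, and for $t\ge t_0$ $$c_{\lambda,m}(t)=\begin{cases}c_\lambda(t)& t\le s^*\\ \lambda_m+\frac{t-s^*}{d-m}& t>s^*\end{cases},\qquad r_{\lambda,m}(t)=\min\{q\in\{0,\dots,d-1\}:c_{\lambda,m}(t)\ge\lambda_{q+1}\}.$$ For $m\le0$ set $c_{\lambda,m}=c_\lambda$ and $r_{\lambda,m}=r_\lambda$. *)

theory Defs
  imports
    "Jordan_Normal_Form.Schur_Decomposition"
    "Jordan_Normal_Form.Gauss_Jordan_Elimination"
    "Jordan_Normal_Form.VS_Connect"
begin

text \<open>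
  The space \<open>H\<close> is \<open>carrier_vec d\<close> over the complex numbers, with inner product
  \<open>\<langle>x, y\<rangle> = x \<bullet>c y\<close> (linear in \<open>x\<close>). Finite sequences of vectors are lists, and operators are
  identified with their matrices in the standard basis. Vectors of reals
  \<open>\<lambda>\<^sub>1, \<dots>, \<lambda>\<^sub>d\<close> and orthonormal bases \<open>h\<^sub>1, \<dots>, h\<^sub>d\<close> are functions on \<open>nat\<close> of which only the
  values at \<open>1, \<dots>, d\<close> matter.
\<close>

subsection \<open>Matrices\<close>

definition mat_trace :: "complex mat \<Rightarrow> complex" where
  "mat_trace A = (\<Sum>i<dim_row A. A $$ (i, i))"

text \<open>\<open>outer x y\<close> is the operator \<open>x \<otimes> y\<close>, i.e. \<open>z \<mapsto> \<langle>z, y\<rangle> x\<close>.\<close>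

definition outer :: "complex vec \<Rightarrow> complex vec \<Rightarrow> complex mat" where
  "outer x y = mat (dim_vec x) (dim_vec y) (\<lambda>(a, b). x $ a * cnj (y $ b))"

text \<open>The sum of a finite family of \<open>d \<times> d\<close> matrices.\<close>

definition mat_sum :: "nat \<Rightarrow> ('i \<Rightarrow> complex mat) \<Rightarrow> 'i set \<Rightarrow> complex mat" where
  "mat_sum d A I = mat d d (\<lambda>(a, b). \<Sum>i\<in>I. A i $$ (a, b))"

text \<open>
  The entries of \<open>\<lambda>(S)\<close>: the roots of the characteristic polynomial, with multiplicity, in
  decreasing order and indexed from 1. This is only meant for Hermitian \<open>S\<close>, where the roots
  are real.
\<close>

definition eigval :: "complex mat \<Rightarrow> nat \<Rightarrow> real" where
  "eigval S i =
     rev (sorted_list_of_multiset (image_mset Re (proots (char_poly S)))) ! (i - 1)"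

text \<open>
  Orthonormal basis of eigenvectors for \<open>S, \<lambda>\<close>. (Being \<open>d\<close> orthonormal vectors of \<open>carrier_vec d\<close>,
  the \<open>h i\<close> form a basis.)
\<close>

definition eigen_onb :: "nat \<Rightarrow> complex mat \<Rightarrow> (nat \<Rightarrow> real) \<Rightarrow> (nat \<Rightarrow> complex vec) \<Rightarrow> bool" where
  "eigen_onb d S lam h \<longleftrightarrow>
     (\<forall>i\<in>{1..d}. h i \<in> carrier_vec d) \<and>
     (\<forall>i\<in>{1..d}. \<forall>j\<in>{1..d}. h i \<bullet>c h j = (if i = j then 1 else 0)) \<and>
     (\<forall>i\<in>{1..d}. S *\<^sub>v h i = complex_of_real (lam i) \<cdot>\<^sub>v h i)"

text \<open>
  Functional calculus \<open>f(S)\<close> for Hermitian \<open>S\<close>; the sum does not depend on the choice of the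
  orthonormal basis of eigenvectors.
\<close>

definition fun_calc :: "nat \<Rightarrow> (real \<Rightarrow> real) \<Rightarrow> complex mat \<Rightarrow> complex mat" where
  "fun_calc d f S = (THE A. \<exists>h. eigen_onb d S (eigval S) h \<and>
     A = mat_sum d (\<lambda>i. complex_of_real (f (eigval S i)) \<cdot>\<^sub>m outer (h i) (h i)) {1..d})"

subsection \<open>Frames and their duals\<close>

text \<open>The matrix of \<open>T\<^sub>F : x \<mapsto> (\<langle>x, f\<^sub>i\<rangle>)\<^sub>i\<close>; its \<open>i\<close>-th row is the conjugate of \<open>f\<^sub>i\<close>.\<close>

definition analysis_op :: "nat \<Rightarrow> complex vec list \<Rightarrow> complex mat" where
  "analysis_op d F = mat_of_rows d (map conjugate F)"

definition frame_op :: "nat \<Rightarrow> complex vec list \<Rightarrow> complex mat" where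
  "frame_op d F = mat_adjoint (analysis_op d F) * analysis_op d F"

definition frames :: "nat \<Rightarrow> nat \<Rightarrow> complex vec list set" where
  "frames n d = {F. length F = n \<and> set F \<subseteq> carrier_vec d \<and>
     LinearCombinations.module.span class_ring (module_vec TYPE(complex) d) (set F)
       = carrier_vec d}"

definition frame_op_inv :: "nat \<Rightarrow> complex vec list \<Rightarrow> complex mat" where
  "frame_op_inv d F = the (mat_inverse (frame_op d F))"

text \<open>Traces of frame operators are real, so taking the real part below loses nothing.\<close>

definition duals :: "nat \<Rightarrow> nat \<Rightarrow> real \<Rightarrow> complex vec list \<Rightarrow> complex vec list set" where
  "duals n d t F = {G \<in> frames n d.
     mat_adjoint (analysis_op d G) * analysis_op d F = 1\<^sub>m d \<and>
     Re (mat_trace (frame_op d G)) \<ge> t}"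

definition dual_frame_ops :: "nat \<Rightarrow> nat \<Rightarrow> real \<Rightarrow> complex vec list \<Rightarrow> complex mat set" where
  "dual_frame_ops n d t F = frame_op d ` duals n d t F"

definition frame_potential :: "nat \<Rightarrow> (real \<Rightarrow> real) \<Rightarrow> complex vec list \<Rightarrow> real" where
  "frame_potential d f G = Re (mat_trace (fun_calc d f (frame_op d G)))"

subsection \<open>The quantities attached to a decreasing vector\<close>

definition p_lam :: "nat \<Rightarrow> (nat \<Rightarrow> real) \<Rightarrow> nat \<Rightarrow> real \<Rightarrow> real" where
  "p_lam d lam q t = (t - (\<Sum>j=1..q. lam j)) / (real d - real q)"

definition r_lam :: "nat \<Rightarrow> (nat \<Rightarrow> real) \<Rightarrow> real \<Rightarrow> nat" where
  "r_lam d lam t = (LEAST q. q < d \<and> p_lam d lam q t \<ge> lam (q + 1))"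

definition c_lam :: "nat \<Rightarrow> (nat \<Rightarrow> real) \<Rightarrow> real \<Rightarrow> real" where
  "c_lam d lam t = p_lam d lam (r_lam d lam t) t"

definition s_star :: "nat \<Rightarrow> (nat \<Rightarrow> real) \<Rightarrow> nat \<Rightarrow> real" where
  "s_star d lam m = (\<Sum>i=1..m. lam i) + (real d - real m) * lam m"

text \<open>The parameter \<open>m\<close> is an integer; nonpositive values mean that there is no constraint.\<close>

definition c_lam_m :: "nat \<Rightarrow> (nat \<Rightarrow> real) \<Rightarrow> int \<Rightarrow> real \<Rightarrow> real" where
  "c_lam_m d lam m t =
     (if m \<le> 0 \<or> t \<le> s_star d lam (nat m) then c_lam d lam t
      else lam (nat m) + (t - s_star d lam (nat m)) / (real d - real_of_int m))"

definition r_lam_m :: "nat \<Rightarrow> (nat \<Rightarrow> real) \<Rightarrow> int \<Rightarrow> real \<Rightarrow> nat" where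
  "r_lam_m d lam m t =
     (if m \<le> 0 then r_lam d lam t
      else (LEAST q. q < d \<and> c_lam_m d lam m t \<ge> lam (q + 1)))"

end

theory Submission
  imports Defs
begin

text \<open>
  Put \<open>A = S\<^sub>F\<^sup>-\<^sup>1\<close>. The frame operators of the duals of \<open>F\<close> are the matrices \<open>S = A + Z\<^sup>* Z\<close>, where the kernel
  of \<open>Z\<close> has dimension at least \<open>m = 2 d - n\<close>. Let \<open>c\<close> be the water-filling level and subtract from
  \<open>f\<close> a support line at \<open>c\<close>; what remains is \<open>P + N\<close> with \<open>P\<close> increasing and supported on
  \<open>x \<ge> c\<close>, and \<open>N\<close> decreasing and supported on \<open>x \<le> c\<close>. By Jensen's inequality
  \<open>tr P(S) \<ge> \<Sum> P(\<langle>S h\<^sub>i, h\<^sub>i\<rangle>) \<ge> \<Sum> P(\<lambda>\<^sub>i)\<close> for an eigenbasis \<open>h\<close> of \<open>A\<close>, because \<open>S \<ge> A\<close>. For \<open>N\<close> one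
  takes instead orthonormal \<open>u\<^sub>1, \<dots>, u\<^sub>m\<close> in the kernel of \<open>Z\<close> with \<open>u\<^sub>i\<close> orthogonal to \<open>h\<^sub>j\<close> for \<open>j < i\<close>, so
  that \<open>\<langle>S u\<^sub>i, u\<^sub>i\<rangle> = \<langle>A u\<^sub>i, u\<^sub>i\<rangle> \<le> \<lambda>\<^sub>i\<close>. If equality holds throughout, strict convexity forces \<open>S\<close> and
  \<open>A\<close> to have a common eigenbasis with the predicted eigenvalues. The bound is attained, since \<open>Z\<close>
  may be any map into the orthogonal complement of the range of \<open>T\<^sub>F\<close>, which has dimension \<open>n - d\<close>.
\<close>

text \<open>No single orthonormal basis serves both parts. On eigenvectors of \<open>A\<close> the
  inequality \<open>S >= A\<close> bounds means of the eigenvalues of \<open>S\<close> from below,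
  but bounds from above are available only on the kernel of \<open>Z\<close>. Splitting at
  \<open>c\<close> lets each part use its own basis, with squared inner products against an
  eigenbasis of \<open>S\<close> as doubly stochastic weights. As \<open>f\<close> increases, the
  support line has positive slope, so a trace larger than \<open>t\<close> only raises the bound.
  The kernel matters only when \<open>t\<close> exceeds \<open>s_star\<close>: otherwise
  \<open>c\<close> is at most \<open>lam m\<close>, and dropping the constraint gives the same
  spectrum; beyond it, the eigenvalues below \<open>c\<close> among the first \<open>m\<close> stay
  where they are. The optimal spectrum is thus tied to indices rather than to eigenvalues: if
  \<open>lam m = lam (m + 1) < c\<close>, one eigenspace of \<open>A\<close> carries two different
  values, and the choice of the eigenbasis matters. The extra conditions of the second part exclude
  exactly this, and the optimal \<open>S\<close> becomes a function of \<open>A\<close>.\<close>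

subsection \<open>Inner products and adjoints\<close>

lemma cscalar_sum:
  fixes x y :: "complex vec"
  assumes "y \<in> carrier_vec d"
  shows "x \<bullet>c y = (\<Sum>a<d. x $ a * cnj (y $ a))"
  using assms by (simp add: scalar_prod_def atLeast0LessThan)

lemma mat_adjoint_carrier:
  assumes "A \<in> carrier_mat n d" shows "mat_adjoint A \<in> carrier_mat d n"
  using assms by (auto simp: mat_adjoint_def mat_of_rows_def)

lemma mat_adjoint_index:
  fixes A :: "complex mat"
  assumes "A \<in> carrier_mat n d" "i < d" "j < n"
  shows "mat_adjoint A $$ (i, j) = cnj (A $$ (j, i))"
  using assms by (simp add: mat_adjoint_def mat_of_rows_index)

lemma cscalar_cnj:
  fixes x y :: "complex vec"
  assumes "x \<in> carrier_vec d" "y \<in> carrier_vec d"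
  shows "cnj (x \<bullet>c y) = y \<bullet>c x"
  using assms by (simp add: cscalar_sum[of _ d] mult.commute)

lemma cscalar_adjoint:
  fixes A :: "complex mat"
  assumes A: "A \<in> carrier_mat n d" and x: "x \<in> carrier_vec d" and y: "y \<in> carrier_vec n"
  shows "(A *\<^sub>v x) \<bullet>c y = x \<bullet>c (mat_adjoint A *\<^sub>v y)"
proof -
  have "(A *\<^sub>v x) \<bullet>c y = (\<Sum>i<n. \<Sum>j<d. A $$ (i, j) * x $ j * cnj (y $ i))"
    using A x y by (simp add: cscalar_sum[of _ n] scalar_prod_def atLeast0LessThan sum_distrib_right)
  also have "\<dots> = (\<Sum>j<d. \<Sum>i<n. A $$ (i, j) * x $ j * cnj (y $ i))"
    by (rule sum.swap)
  also have "\<dots> = (\<Sum>j<d. x $ j * cnj (\<Sum>i<n. cnj (A $$ (i, j)) * y $ i))"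
    by (simp add: sum_distrib_left mult_ac)
  also have "\<dots> = x \<bullet>c (mat_adjoint A *\<^sub>v y)"
  proof -
    have "(mat_adjoint A *\<^sub>v y) $ j = (\<Sum>i<n. cnj (A $$ (i, j)) * y $ i)" if "j < d" for j
      using A y that mat_adjoint_carrier[OF A]
      by (auto simp: scalar_prod_def atLeast0LessThan mat_adjoint_index[OF A] intro!: sum.cong)
    moreover have "mat_adjoint A *\<^sub>v y \<in> carrier_vec d"
      using mat_adjoint_carrier[OF A] y by simp
    ultimately show ?thesis by (subst cscalar_sum[of _ d]) auto
  qed
  finally show ?thesis .
qed

lemma mat_adjoint_adjoint:
  fixes A :: "complex mat"
  assumes A: "A \<in> carrier_mat n d"
  shows "mat_adjoint (mat_adjoint A) = A"
  using A mat_adjoint_carrier[OF A] mat_adjoint_carrier[OF mat_adjoint_carrier[OF A]]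
  by (intro eq_matI) (auto simp: mat_adjoint_index[of _ n d] mat_adjoint_index[of _ d n])

lemma mat_adjoint_mult:
  fixes A B :: "complex mat"
  assumes A: "A \<in> carrier_mat n k" and B: "B \<in> carrier_mat k d"
  shows "mat_adjoint (A * B) = mat_adjoint B * mat_adjoint A"
proof (rule eq_matI)
  note c = mat_adjoint_carrier[OF A] mat_adjoint_carrier[OF B]
    mat_adjoint_carrier[OF mult_carrier_mat[OF A B]]
  fix i j assume "i < dim_row (mat_adjoint B * mat_adjoint A)"
    "j < dim_col (mat_adjoint B * mat_adjoint A)"
  then have i: "i < d" and j: "j < n" using c by auto
  then show "mat_adjoint (A * B) $$ (i, j) = (mat_adjoint B * mat_adjoint A) $$ (i, j)"
    using A B c
    by (simp add: mat_adjoint_index[OF mult_carrier_mat[OF A B]] scalar_prod_def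
        mat_adjoint_index[OF A] mat_adjoint_index[OF B] mult.commute)
qed (use mat_adjoint_carrier[OF A] mat_adjoint_carrier[OF B]
    mat_adjoint_carrier[OF mult_carrier_mat[OF A B]] in auto)

lemma mat_adjoint_one: "mat_adjoint (1\<^sub>m d :: complex mat) = 1\<^sub>m d"
  using mat_adjoint_carrier[of "1\<^sub>m d :: complex mat" d d]
  by (intro eq_matI) (auto simp: mat_adjoint_index[of _ d d])

lemma mat_adjoint_zero: "mat_adjoint (0\<^sub>m n d :: complex mat) = 0\<^sub>m d n"
  using mat_adjoint_carrier[of "0\<^sub>m n d :: complex mat" n d]
  by (intro eq_matI) (auto simp: mat_adjoint_index[of _ n d])

text \<open>Padding the \<open>k\<close> equations with zero rows gives a square matrix whose last
  row is zero. Its transpose kills the last unit vector, so the determinant vanishes.\<close>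

lemma homogeneous_system_solution:
  fixes w :: "nat \<Rightarrow> complex vec"
  assumes "k < N"
  obtains x where "x \<in> carrier_vec N" "x \<noteq> 0\<^sub>v N" "\<And>i. i < k \<Longrightarrow> (\<Sum>a<N. w i $ a * x $ a) = 0"
proof -
  define A where "A = mat N N (\<lambda>(i, j). if i < k then w i $ j else 0)"
  have A: "A \<in> carrier_mat N N" by (simp add: A_def)
  have "transpose_mat A *\<^sub>v unit_vec N (N - 1) = 0\<^sub>v N"
    using assms by (intro eq_vecI) (auto simp: A_def)
  then have "det (transpose_mat A) = 0"
    using assms A
    by (subst det_0_iff_vec_prod_zero[of _ N]) (auto intro!: exI[of _ "unit_vec N (N - 1)"])
  then have "det A = 0" using A by (simp add: det_transpose)
  then obtain x where x: "x \<in> carrier_vec N" "x \<noteq> 0\<^sub>v N" "A *\<^sub>v x = 0\<^sub>v N"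
    using det_0_iff_vec_prod_zero[OF A] by auto
  have "(\<Sum>a<N. w i $ a * x $ a) = 0" if "i < k" for i
  proof -
    have "(A *\<^sub>v x) $ i = (\<Sum>a<N. w i $ a * x $ a)"
      using that assms x(1) by (simp add: A_def scalar_prod_def atLeast0LessThan)
    then show ?thesis using that assms by (simp add: x(3))
  qed
  then show ?thesis using that x by blast
qed

section \<open>Unit vectors orthogonal to a given family\<close>

lemma cscalar_smult:
  fixes x y :: "complex vec"
  assumes "x \<in> carrier_vec d" "y \<in> carrier_vec d"
  shows "(a \<cdot>\<^sub>v x) \<bullet>c y = a * (x \<bullet>c y)" "x \<bullet>c (a \<cdot>\<^sub>v y) = cnj a * (x \<bullet>c y)"
  using assms by (simp_all add: cscalar_sum[of _ d] sum_distrib_left mult_ac)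

lemma cscalar_self:
  fixes x :: "complex vec"
  assumes "x \<in> carrier_vec d"
  shows "x \<bullet>c x = complex_of_real (\<Sum>a<d. (cmod (x $ a))\<^sup>2)"
  using assms by (simp add: cscalar_sum[of _ d] flip: complex_norm_square)

lemma cscalar_self_eq_0:
  fixes x :: "complex vec"
  assumes "x \<in> carrier_vec d"
  shows "x \<bullet>c x = 0 \<longleftrightarrow> x = 0\<^sub>v d"
  by (rule conjugate_square_eq_0_vec[OF assms])

lemma normalize_vec:
  fixes x :: "complex vec"
  assumes x: "x \<in> carrier_vec d" "x \<noteq> 0\<^sub>v d"
  obtains a where "a \<noteq> 0" "(a \<cdot>\<^sub>v x) \<bullet>c (a \<cdot>\<^sub>v x) = 1"
proof -
  define s where "s = (\<Sum>a<d. (cmod (x $ a))\<^sup>2)"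
  have "s \<noteq> 0" using cscalar_self[OF x(1)] cscalar_self_eq_0[OF x(1)] x(2) unfolding s_def by force
  moreover have "s \<ge> 0" unfolding s_def by (intro sum_nonneg) auto
  ultimately have s: "s > 0" by auto
  define a where "a = complex_of_real (1 / sqrt s)"
  have "(a \<cdot>\<^sub>v x) \<bullet>c (a \<cdot>\<^sub>v x) = a * cnj a * (x \<bullet>c x)"
    using x(1) by (subst cscalar_smult[of _ d]; simp add: cscalar_smult[of _ d])
  also have "\<dots> = complex_of_real (1 / sqrt s * (1 / sqrt s) * s)"
    unfolding cscalar_self[OF x(1)] s_def[symmetric] a_def
    by (simp only: complex_cnj_complex_of_real of_real_mult)
  also have "1 / sqrt s * (1 / sqrt s) * s = 1" using s by simp
  finally show ?thesis using s by (intro that[of a]) (auto simp: a_def)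
qed

text \<open>This stands in for dimension theory: eigenvectors, basis extensions and the cokernel of
  \<open>T\<close> are all obtained by counting fewer than \<open>d\<close> orthogonality
  conditions.\<close>

lemma orthogonal_unit_vec:
  assumes ws: "set ws \<subseteq> carrier_vec d" and len: "length ws < d"
  obtains x :: "complex vec" where "x \<in> carrier_vec d" "x \<bullet>c x = 1" "\<And>w. w \<in> set ws \<Longrightarrow> x \<bullet>c w = 0"
proof -
  obtain x where x: "x \<in> carrier_vec d" "x \<noteq> 0\<^sub>v d"
    and sol: "\<And>i. i < length ws \<Longrightarrow> (\<Sum>a<d. conjugate (ws ! i) $ a * x $ a) = 0"
    using homogeneous_system_solution[OF len, of "\<lambda>i. conjugate (ws ! i)"] by blast
  have orth: "x \<bullet>c w = 0" if w: "w \<in> set ws" for w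
  proof -
    obtain i where i: "i < length ws" "w = ws ! i" using w by (metis in_set_conv_nth)
    have "w \<in> carrier_vec d" using ws w by auto
    then show ?thesis using sol[OF i(1)] i(2) by (simp add: cscalar_sum[of _ d] mult.commute)
  qed
  obtain a where "a \<noteq> 0" "(a \<cdot>\<^sub>v x) \<bullet>c (a \<cdot>\<^sub>v x) = 1" using normalize_vec[OF x] by blast
  then show ?thesis
    using x(1) orth ws by (intro that[of "a \<cdot>\<^sub>v x"]) (auto simp: cscalar_smult[of _ d] subset_iff)
qed

subsection \<open>Orthonormal bases and functional calculus\<close>

definition onb :: "nat \<Rightarrow> (nat \<Rightarrow> complex vec) \<Rightarrow> bool" where
  "onb d h \<longleftrightarrow> (\<forall>i\<in>{1..d}. h i \<in> carrier_vec d) \<and>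
     (\<forall>i\<in>{1..d}. \<forall>j\<in>{1..d}. h i \<bullet>c h j = (if i = j then 1 else 0))"

lemma onbD:
  assumes "onb d h" "i \<in> {1..d}"
  shows "h i \<in> carrier_vec d" "j \<in> {1..d} \<Longrightarrow> h i \<bullet>c h j = (if i = j then 1 else 0)"
  using assms by (auto simp: onb_def)

lemma onb_dim: "onb d h \<Longrightarrow> i \<in> {1..d} \<Longrightarrow> dim_vec (h i) = d"
  by (auto dest: onbD(1))

lemma eigen_onb_iff:
  "eigen_onb d S a h \<longleftrightarrow> onb d h \<and> (\<forall>i\<in>{1..d}. S *\<^sub>v h i = complex_of_real (a i) \<cdot>\<^sub>v h i)"
  by (auto simp: eigen_onb_def onb_def)

text \<open>If \<open>H\<close> has the columns \<open>h 1, ..., h d\<close>, orthonormality says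
  that the adjoint of \<open>H\<close> is a left inverse. For a square matrix it is then a right
  inverse, and its entries give the completeness relation.\<close>

lemma onb_resolution:
  assumes h: "onb d h" and a: "a < d" and b: "b < d"
  shows "(\<Sum>i=1..d. h i $ a * cnj (h i $ b)) = (if a = b then 1 else 0)"
proof -
  define H where "H = mat d d (\<lambda>(a, i). h (Suc i) $ a)"
  have H: "H \<in> carrier_mat d d" by (simp add: H_def)
  have Hi: "H $$ (a, i) = h (Suc i) $ a" if "a < d" "i < d" for a i
    using that by (simp add: H_def)
  note H' = mat_adjoint_carrier[OF H]
  have "mat_adjoint H * H = 1\<^sub>m d"
  proof (rule eq_matI)
    fix i j assume "i < dim_row (1\<^sub>m d :: complex mat)" "j < dim_col (1\<^sub>m d :: complex mat)"
    then have ij: "i < d" "j < d" by auto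
    have "(mat_adjoint H * H) $$ (i, j) = (\<Sum>k<d. cnj (h (Suc i) $ k) * h (Suc j) $ k)"
      using ij H H'
      by (auto simp: scalar_prod_def atLeast0LessThan mat_adjoint_index[OF H] Hi intro!: sum.cong)
    also have "\<dots> = h (Suc j) \<bullet>c h (Suc i)"
      using onbD(1)[OF h, of "Suc i"] ij by (simp add: cscalar_sum[of _ d] mult.commute)
    finally show "(mat_adjoint H * H) $$ (i, j) = 1\<^sub>m d $$ (i, j)"
      using onbD(2)[OF h, of "Suc j" "Suc i"] ij by simp
  qed (use H H' in auto)
  then have "H * mat_adjoint H = 1\<^sub>m d" using mat_mult_left_right_inverse[OF H' H] by simp
  then have "(H * mat_adjoint H) $$ (a, b) = (if a = b then 1 else 0)" using a b by simp
  moreover have "(H * mat_adjoint H) $$ (a, b) = (\<Sum>i<d. h (Suc i) $ a * cnj (h (Suc i) $ b))"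
    using a b H H'
    by (auto simp: scalar_prod_def atLeast0LessThan mat_adjoint_index[OF H] Hi intro!: sum.cong)
  moreover have "\<dots> = (\<Sum>i=1..d. h i $ a * cnj (h i $ b))"
    by (rule sum.reindex_bij_witness[of _ "\<lambda>i. i - 1" Suc]) auto
  ultimately show ?thesis by simp
qed

lemma onb_expand:
  assumes h: "onb d h" and x: "x \<in> carrier_vec d" and a: "a < d"
  shows "x $ a = (\<Sum>i=1..d. (x \<bullet>c h i) * h i $ a)"
proof -
  have "(\<Sum>i=1..d. (x \<bullet>c h i) * h i $ a) = (\<Sum>i=1..d. \<Sum>b<d. x $ b * (h i $ a * cnj (h i $ b)))"
    using onbD(1)[OF h] by (intro sum.cong) (auto simp: cscalar_sum[of _ d] sum_distrib_left mult_ac)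
  also have "\<dots> = (\<Sum>b<d. x $ b * (\<Sum>i=1..d. h i $ a * cnj (h i $ b)))"
    by (subst sum.swap) (simp add: sum_distrib_left)
  also have "\<dots> = (\<Sum>b<d. if b = a then x $ b else 0)"
    by (intro sum.cong) (auto simp: onb_resolution[OF h a] simp del: One_nat_def)
  finally show ?thesis using a by simp
qed

lemma onb_vec_eqI:
  assumes h: "onb d h" and x: "x \<in> carrier_vec d" and y: "y \<in> carrier_vec d"
    and eq: "\<And>i. i \<in> {1..d} \<Longrightarrow> x \<bullet>c h i = y \<bullet>c h i"
  shows "x = y"
  using x y eq by (intro eq_vecI) (auto simp: onb_expand[OF h])

lemma onb_parseval:
  assumes h: "onb d h" and x: "x \<in> carrier_vec d" and y: "y \<in> carrier_vec d"
  shows "x \<bullet>c y = (\<Sum>i=1..d. (x \<bullet>c h i) * (h i \<bullet>c y))"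
proof -
  have "x \<bullet>c y = (\<Sum>a<d. \<Sum>i=1..d. (x \<bullet>c h i) * (h i $ a * cnj (y $ a)))"
    using x y
    by (auto simp: cscalar_sum[of y d] sum_distrib_right onb_expand[OF h x] mult.assoc
        simp del: conjugate_complex_def intro!: sum.cong)
  also have "\<dots> = (\<Sum>i=1..d. (x \<bullet>c h i) * (h i \<bullet>c y))"
    by (subst sum.swap) (simp add: sum_distrib_left cscalar_sum[OF y])
  finally show ?thesis .
qed

text \<open>Applied along two orthonormal bases, in both orders, this makes the squared inner
  products a doubly stochastic matrix: the weights for Jensen's inequality.\<close>

lemma onb_weights:
  assumes "onb d h" "x \<in> carrier_vec d" "x \<bullet>c x = 1"
  shows "(\<Sum>i=1..d. (cmod (x \<bullet>c h i))\<^sup>2) = 1"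
proof -
  have "x \<bullet>c x = (\<Sum>i=1..d. (x \<bullet>c h i) * cnj (x \<bullet>c h i))"
    using assms onbD(1)[OF assms(1)]
    by (subst onb_parseval[OF assms(1,2,2)]) (auto intro!: sum.cong simp: cscalar_cnj[of _ d])
  also have "\<dots> = complex_of_real (\<Sum>i=1..d. (cmod (x \<bullet>c h i))\<^sup>2)"
    by (simp only: complex_norm_square[symmetric] of_real_sum)
  finally show ?thesis using assms(3) by (metis of_real_eq_1_iff)
qed

lemma onb_mat_eqI:
  assumes h: "onb d h" and A: "A \<in> carrier_mat n d" and B: "B \<in> carrier_mat n d"
    and eq: "\<And>i. i \<in> {1..d} \<Longrightarrow> A *\<^sub>v h i = B *\<^sub>v h i"
  shows "A = B"
proof -
  have *: "C $$ (r, b) = (\<Sum>i=1..d. (C *\<^sub>v h i) $ r * cnj (h i $ b))"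
    if C: "C \<in> carrier_mat n d" and r: "r < n" and b: "b < d" for C r b
  proof -
    have "(\<Sum>i=1..d. (C *\<^sub>v h i) $ r * cnj (h i $ b))
        = (\<Sum>i=1..d. \<Sum>a<d. C $$ (r, a) * (h i $ a * cnj (h i $ b)))"
      using C r onb_dim[OF h]
      by (intro sum.cong) (auto simp: scalar_prod_def atLeast0LessThan sum_distrib_right mult.assoc)
    also have "\<dots> = (\<Sum>a<d. C $$ (r, a) * (\<Sum>i=1..d. h i $ a * cnj (h i $ b)))"
      by (subst sum.swap) (simp add: sum_distrib_left)
    also have "\<dots> = (\<Sum>a<d. if a = b then C $$ (r, a) else 0)"
      by (intro sum.cong) (auto simp: onb_resolution[OF h _ b] simp del: One_nat_def)
    finally show ?thesis using b by simp
  qed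
  show ?thesis
    using A B by (intro eq_matI) (auto simp: *[OF A] *[OF B] eq simp del: index_mult_mat_vec)
qed

section \<open>Spectral sums and their independence of the eigenbasis\<close>

abbreviation (input) spectral_sum ::
    "nat \<Rightarrow> (nat \<Rightarrow> real) \<Rightarrow> (nat \<Rightarrow> complex vec) \<Rightarrow> nat set \<Rightarrow> complex mat" where
  "spectral_sum d c h I \<equiv> mat_sum d (\<lambda>i. complex_of_real (c i) \<cdot>\<^sub>m outer (h i) (h i)) I"

lemma spectral_sum_carrier: "mat_sum d X I \<in> carrier_mat d d"
  by (simp add: mat_sum_def)

lemma spectral_sum_onb:
  assumes h: "onb d h" and I: "I \<subseteq> {1..d}" and j: "j \<in> {1..d}"
  shows "spectral_sum d c h I *\<^sub>v h j = complex_of_real (if j \<in> I then c j else 0) \<cdot>\<^sub>v h j"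
proof (rule eq_vecI)
  have fin: "finite I" using I finite_subset by blast
  fix a assume "a < dim_vec (complex_of_real (if j \<in> I then c j else 0) \<cdot>\<^sub>v h j)"
  then have a: "a < d" using onbD(1)[OF h j] by simp
  have "(spectral_sum d c h I *\<^sub>v h j) $ a
      = (\<Sum>b<d. \<Sum>i\<in>I. complex_of_real (c i) * (h i $ a * cnj (h i $ b)) * h j $ b)"
    using a onb_dim[OF h] I j
    by (auto simp: mat_sum_def scalar_prod_def atLeast0LessThan sum_distrib_right outer_def subset_iff
        intro!: sum.cong)
  also have "\<dots> = (\<Sum>i\<in>I. complex_of_real (c i) * h i $ a * (h j \<bullet>c h i))"
    using onbD(1)[OF h] I
    by (subst sum.swap) (auto simp: cscalar_sum[of _ d] sum_distrib_left mult_ac intro!: sum.cong)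
  also have "\<dots> = (\<Sum>i\<in>I. if i = j then complex_of_real (c i) * h i $ a else 0)"
    using onbD(2)[OF h j] I by (intro sum.cong) auto
  finally show "(spectral_sum d c h I *\<^sub>v h j) $ a
      = (complex_of_real (if j \<in> I then c j else 0) \<cdot>\<^sub>v h j) $ a"
    using a onbD(1)[OF h j] fin by simp
qed (use onbD(1)[OF h j] in \<open>simp add: mat_sum_def\<close>)

lemma eigen_onb_spectral_sum:
  assumes "onb d g"
  shows "eigen_onb d (spectral_sum d c g {1..d}) c g"
  unfolding eigen_onb_iff using assms
  by (intro conjI ballI) (simp_all only: spectral_sum_onb[OF assms order_refl] if_True)

lemma trace_spectral_sum:
  assumes h: "onb d h"
  shows "mat_trace (spectral_sum d c h {1..d}) = complex_of_real (\<Sum>i=1..d. c i)"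
proof -
  have "mat_trace (spectral_sum d c h {1..d})
      = (\<Sum>a<d. \<Sum>i=1..d. complex_of_real (c i) * (h i $ a * cnj (h i $ a)))"
    using onb_dim[OF h] by (auto simp: mat_trace_def mat_sum_def outer_def intro!: sum.cong)
  also have "\<dots> = (\<Sum>i=1..d. complex_of_real (c i) * (h i \<bullet>c h i))"
    using onbD(1)[OF h] by (subst sum.swap) (simp add: cscalar_sum[of _ d] sum_distrib_left)
  also have "\<dots> = complex_of_real (\<Sum>i=1..d. c i)"
    using onbD(2)[OF h] by simp
  finally show ?thesis .
qed

lemma eigen_decomposition:
  assumes "eigen_onb d S a g" "S \<in> carrier_mat d d"
  shows "S = spectral_sum d a g {1..d}"
  using assms unfolding eigen_onb_iff
  by (intro onb_mat_eqI[of d g S d]) (auto simp: spectral_sum_carrier spectral_sum_onb)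

text \<open>The spectral decomposition of \<open>S\<close> takes the role of self-adjointness: only
  the summand with index \<open>j\<close> survives the inner product with
  \<open>g j\<close>.\<close>

lemma eigen_cscalar:
  assumes g: "eigen_onb d S a g" and S: "S \<in> carrier_mat d d"
    and x: "x \<in> carrier_vec d" and j: "j \<in> {1..d}"
  shows "(S *\<^sub>v x) \<bullet>c g j = complex_of_real (a j) * (x \<bullet>c g j)"
proof -
  have o: "onb d g" using g by (simp add: eigen_onb_iff)
  have "(S *\<^sub>v x) $ b = (\<Sum>i=1..d. complex_of_real (a i) * (x \<bullet>c g i) * g i $ b)" if b: "b < d" for b
  proof -
    have "(S *\<^sub>v x) $ b = (\<Sum>k<d. \<Sum>i=1..d. complex_of_real (a i) * (g i $ b * cnj (g i $ k)) * x $ k)"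
      using b x onb_dim[OF o]
      by (subst eigen_decomposition[OF g S])
        (auto simp: mat_sum_def scalar_prod_def atLeast0LessThan sum_distrib_right outer_def intro!: sum.cong)
    also have "\<dots> = (\<Sum>i=1..d. complex_of_real (a i) * (x \<bullet>c g i) * g i $ b)"
      using onbD(1)[OF o]
      by (subst sum.swap) (auto simp: cscalar_sum[of _ d] sum_distrib_left sum_distrib_right mult_ac intro!: sum.cong)
    finally show ?thesis .
  qed
  then have "(S *\<^sub>v x) \<bullet>c g j
      = (\<Sum>b<d. \<Sum>i=1..d. complex_of_real (a i) * (x \<bullet>c g i) * (g i $ b * cnj (g j $ b)))"
    using onbD(1)[OF o j]
    by (auto simp: cscalar_sum[of "g j" d] sum_distrib_right mult.assoc simp del: conjugate_complex_def
        intro!: sum.cong)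
  also have "\<dots> = (\<Sum>i=1..d. complex_of_real (a i) * (x \<bullet>c g i) * (g i \<bullet>c g j))"
    by (subst sum.swap) (simp add: cscalar_sum[OF onbD(1)[OF o j]] sum_distrib_left)
  also have "\<dots> = (\<Sum>i=1..d. if i = j then complex_of_real (a i) * (x \<bullet>c g i) else 0)"
    using onbD(2)[OF o _ j] by (intro sum.cong) auto
  finally show ?thesis using j by simp
qed

text \<open>A vector that meets only eigenvectors with eigenvalue \<open>e\<close> lies in that
  eigenspace. In this form the equality cases of Jensen's inequality, which speak about nonzero
  weights, become statements about eigenvectors.\<close>

lemma eigenvectorI:
  assumes g: "eigen_onb d S a g" and S: "S \<in> carrier_mat d d" and x: "x \<in> carrier_vec d"
    and supp: "\<And>j. j \<in> {1..d} \<Longrightarrow> x \<bullet>c g j \<noteq> 0 \<Longrightarrow> a j = e"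
  shows "S *\<^sub>v x = complex_of_real e \<cdot>\<^sub>v x"
proof (rule onb_vec_eqI)
  show "onb d g" using g by (simp add: eigen_onb_iff)
  fix i assume i: "i \<in> {1..d}"
  then have "g i \<in> carrier_vec d" using g by (simp add: eigen_onb_def)
  then show "(S *\<^sub>v x) \<bullet>c g i = (complex_of_real e \<cdot>\<^sub>v x) \<bullet>c g i"
    using supp[OF i] x by (cases "x \<bullet>c g i = 0") (auto simp: eigen_cscalar[OF g S x i] cscalar_smult[of _ d])
qed (use S x in auto)

text \<open>Computing the inner product of \<open>S h i\<close> with \<open>g j\<close> through
  either basis gives \<open>a j\<close> and \<open>b i\<close> times the same nonzero
  number.\<close>

lemma eigenvalues_match:
  assumes g: "eigen_onb d S a g" and h: "eigen_onb d S b h" and S: "S \<in> carrier_mat d d"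
    and i: "i \<in> {1..d}" and j: "j \<in> {1..d}" and ne: "h i \<bullet>c g j \<noteq> 0"
  shows "a j = b i"
proof -
  have c: "h i \<in> carrier_vec d" "g j \<in> carrier_vec d" using g h i j by (auto simp: eigen_onb_def)
  have "complex_of_real (a j) * (h i \<bullet>c g j) = (S *\<^sub>v h i) \<bullet>c g j"
    using eigen_cscalar[OF g S c(1) j] by simp
  also have "\<dots> = complex_of_real (b i) * (h i \<bullet>c g j)"
    using h i c by (simp add: eigen_onb_def cscalar_smult[of _ d])
  finally show ?thesis using ne by simp
qed

text \<open>Each \<open>h i\<close> meets only those \<open>g j\<close> with
  \<open>a j = b i\<close>, so it is an eigenvector of the sum over \<open>g\<close> with eigenvalue
  \<open>f (b i)\<close>. This makes the description in \<open>fun_calc\<close> definite, and it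
  later yields the uniqueness of the optimal frame operator.\<close>

lemma spectral_sum_unique:
  assumes g: "eigen_onb d S a g" and h: "eigen_onb d S b h" and S: "S \<in> carrier_mat d d"
  shows "spectral_sum d (\<lambda>i. f (a i)) g {1..d} = spectral_sum d (\<lambda>i. f (b i)) h {1..d}"
proof (rule onb_mat_eqI)
  have o: "onb d g" "onb d h" using g h by (auto simp: eigen_onb_iff)
  then show "onb d h" by simp
  let ?A = "spectral_sum d (\<lambda>i. f (a i)) g {1..d}"
  note A = eigen_onb_spectral_sum[OF o(1), of "\<lambda>i. f (a i)"]
  fix i assume i: "i \<in> {1..d}"
  have "?A *\<^sub>v h i = complex_of_real (f (b i)) \<cdot>\<^sub>v h i"
    using onbD(1)[OF o(2) i] eigenvalues_match[OF g h S i]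
    by (intro eigenvectorI[OF A]) (auto simp: spectral_sum_carrier)
  then show "?A *\<^sub>v h i = spectral_sum d (\<lambda>i. f (b i)) h {1..d} *\<^sub>v h i"
    using spectral_sum_onb[OF o(2) order_refl i] i by simp
qed (rule spectral_sum_carrier)+

text \<open>\<open>ev\<close> supplies the existence half of the \<open>THE\<close> in
  \<open>fun_calc\<close>, where the basis must follow the order of \<open>eigval\<close>. The value
  can then be read off any eigenbasis, with the eigenvalues in any order.\<close>

lemma trace_fun_calc:
  assumes ev: "eigen_onb d S (eigval S) h" and g: "eigen_onb d S a g" and S: "S \<in> carrier_mat d d"
  shows "mat_trace (fun_calc d f S) = complex_of_real (\<Sum>i=1..d. f (a i))"
proof -
  have "fun_calc d f S = spectral_sum d (\<lambda>i. f (a i)) g {1..d}"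
    unfolding fun_calc_def
  proof (rule the_equality)
    show "\<exists>h. eigen_onb d S (eigval S) h \<and> spectral_sum d (\<lambda>i. f (a i)) g {1..d}
        = spectral_sum d (\<lambda>i. f (eigval S i)) h {1..d}"
      using ev spectral_sum_unique[OF g ev S] by blast
  qed (use spectral_sum_unique[OF _ g S] in \<open>elim exE conjE, simp del: One_nat_def\<close>)
  then show ?thesis using g trace_spectral_sum[of d g "\<lambda>i. f (a i)"] by (simp add: eigen_onb_iff)
qed

lemma trace_eigen:
  assumes g: "eigen_onb d S a g" and S: "S \<in> carrier_mat d d"
  shows "mat_trace S = complex_of_real (\<Sum>i=1..d. a i)"
  using trace_spectral_sum[of d g a] g eigen_decomposition[OF g S] by (simp add: eigen_onb_iff)

lemma eigen_quadratic_form: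
  assumes g: "eigen_onb d S a g" and S: "S \<in> carrier_mat d d" and x: "x \<in> carrier_vec d"
  shows "(S *\<^sub>v x) \<bullet>c x = complex_of_real (\<Sum>i=1..d. (cmod (x \<bullet>c g i))\<^sup>2 * a i)"
proof -
  have o: "onb d g" using g by (simp add: eigen_onb_iff)
  have "(S *\<^sub>v x) \<bullet>c x = (\<Sum>i=1..d. complex_of_real (a i) * ((x \<bullet>c g i) * cnj (x \<bullet>c g i)))"
    using S x onbD(1)[OF o]
    by (subst onb_parseval[OF o]) (auto intro!: sum.cong simp: eigen_cscalar[OF g S x] cscalar_cnj[of _ d])
  also have "\<dots> = complex_of_real (\<Sum>i=1..d. (cmod (x \<bullet>c g i))\<^sup>2 * a i)"
    by (simp only: complex_norm_square[symmetric] of_real_sum of_real_mult mult.commute)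
  finally show ?thesis .
qed

subsection \<open>The spectral theorem\<close>

lemma hermitian_eigenvalue_real:
  assumes A: "A \<in> carrier_mat n n" and her: "mat_adjoint A = A"
    and ev: "A *\<^sub>v x = e \<cdot>\<^sub>v x" and x: "x \<in> carrier_vec n" "x \<noteq> 0\<^sub>v n"
  shows "cnj e = e"
proof -
  have "e * (x \<bullet>c x) = (A *\<^sub>v x) \<bullet>c x" using ev x by (simp add: cscalar_smult[of _ n])
  also have "\<dots> = x \<bullet>c (A *\<^sub>v x)" using cscalar_adjoint[OF A x(1) x(1)] her by simp
  also have "\<dots> = cnj e * (x \<bullet>c x)" using ev x by (simp add: cscalar_smult[of _ n])
  finally show ?thesis using cscalar_self_eq_0[OF x(1)] x(2) by auto
qed

lemma char_poly_proots:
  assumes A: "(A :: complex mat) \<in> carrier_mat n n"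
  shows "char_poly A = (\<Prod>x\<in>#proots (char_poly A). [:- x, 1:])" "size (proots (char_poly A)) = n"
proof -
  have "monic (char_poly A)" "degree (char_poly A) = n" using degree_monic_char_poly[OF A] by auto
  then show "char_poly A = (\<Prod>x\<in>#proots (char_poly A). [:- x, 1:])"
    using complex_poly_decompose_multiset[of "char_poly A"] by simp
  show "size (proots (char_poly A)) = n"
    using size_proots_complex \<open>degree (char_poly A) = n\<close> by metis
qed

text \<open>The roots are eigenvalues of a Hermitian matrix, hence real, so nothing is lost by the
  \<open>Re\<close> in \<open>eigval\<close>. The ordered list is what the Schur form takes as its
  prescribed diagonal; \<open>es\<close> counts from 0 and \<open>eigval\<close> from 1.\<close>

lemma eigval_list:
  assumes A: "A \<in> carrier_mat n n" and her: "mat_adjoint A = A"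
  obtains es where "char_poly A = (\<Prod>e\<leftarrow>map complex_of_real es. [:- e, 1:])" "length es = n"
    "sorted (rev es)" "\<And>i. i < n \<Longrightarrow> eigval A (Suc i) = es ! i"
proof -
  let ?M = "proots (char_poly A)"
  define es where "es = rev (sorted_list_of_multiset (image_mset Re ?M))"
  have cp0: "char_poly A \<noteq> 0" using degree_monic_char_poly[OF A] by auto
  have real: "complex_of_real (Re x) = x" if "x \<in># ?M" for x
  proof -
    have "poly (char_poly A) x = 0" using that cp0 by simp
    then have "eigenvalue A x" using eigenvalue_root_char_poly[OF A] by simp
    then obtain v where "v \<in> carrier_vec n" "v \<noteq> 0\<^sub>v n" "A *\<^sub>v v = x \<cdot>\<^sub>v v"
      using A unfolding eigenvalue_def eigenvector_def by auto
    then have "cnj x = x" using hermitian_eigenvalue_real[OF A her] by blast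
    then show ?thesis by (simp add: complex_eq_iff)
  qed
  have mset: "mset (map complex_of_real es) = ?M"
  proof -
    have "mset (map complex_of_real es) = image_mset complex_of_real (image_mset Re ?M)"
      unfolding es_def by (simp flip: image_mset.compositionality)
    also have "\<dots> = image_mset (\<lambda>x. x) ?M"
      unfolding multiset.map_comp by (intro image_mset_cong) (simp add: real)
    finally show ?thesis by simp
  qed
  show ?thesis
  proof
    show "char_poly A = (\<Prod>e\<leftarrow>map complex_of_real es. [:- e, 1:])"
      by (subst char_poly_proots(1)[OF A], subst mset[symmetric])
        (simp add: prod_mset_prod_list[symmetric] image_mset.compositionality o_def flip: mset_map)
    show "length es = n"
      using arg_cong[OF mset, of size] char_poly_proots(2)[OF A] by simp
    show "sorted (rev es)" unfolding es_def by (simp only: rev_rev_ident sorted_sorted_list_of_multiset)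
    show "eigval A (Suc i) = es ! i" for i by (simp add: eigval_def es_def)
  qed
qed

lemma eigval_antimono:
  assumes A: "A \<in> carrier_mat n n" and her: "mat_adjoint A = A"
    and ij: "1 \<le> i" "i \<le> j" "j \<le> n"
  shows "eigval A j \<le> eigval A i"
proof -
  obtain es where es: "length es = n" "sorted (rev es)" "\<And>i. i < n \<Longrightarrow> eigval A (Suc i) = es ! i"
    using eigval_list[OF A her] by blast
  have "es ! (j - 1) \<le> es ! (i - 1)" using es(1,2) ij by (intro sorted_rev_nth_mono) auto
  then show ?thesis using es(3)[of "i - 1"] es(3)[of "j - 1"] ij by simp
qed

text \<open>If \<open>A = P B Q\<close> is a Schur form with flag \<open>V\<^sub>k\<close> spanned by the first \<open>k\<close> columns of \<open>P\<close>, then any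
  unit vector of \<open>V\<^sub>k\<^sub>+\<^sub>1\<close> orthogonal to \<open>V\<^sub>k\<close> is an eigenvector.\<close>

lemma hermitian_eigen_onb:
  assumes A: "A \<in> carrier_mat n n" and her: "mat_adjoint A = A"
  obtains h where "eigen_onb n A (eigval A) h"
proof -
  obtain es where cp: "char_poly A = (\<Prod>e\<leftarrow>map complex_of_real es. [:- e, 1:])"
    and len: "length es = n" and es: "\<And>i. i < n \<Longrightarrow> eigval A (Suc i) = es ! i"
    using eigval_list[OF A her] by metis
  \<comment> \<open>Prescribing the diagonal as \<open>es\<close> attaches the eigenvalue
    \<open>eigval A i\<close> to \<open>h i\<close>, so multiplicities never have to be
    compared.\<close>
  obtain B P Q where "schur_decomposition A (map complex_of_real es) = (B, P, Q)"
    using prod_cases3 by blast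
  from schur_decomposition[OF A cp this]
  have sim: "similar_mat_wit A B P Q" and ut: "upper_triangular B"
    and diag: "diag_mat B = map complex_of_real es" by auto
  from similar_mat_witD2[OF A sim]
  have PQ: "P * Q = 1\<^sub>m n" "Q * P = 1\<^sub>m n" "A = P * B * Q"
    and car: "B \<in> carrier_mat n n" "P \<in> carrier_mat n n" "Q \<in> carrier_mat n n" by auto
  define V where "V k = {P *\<^sub>v y | y. y \<in> carrier_vec n \<and> (\<forall>j<n. k \<le> j \<longrightarrow> y $ j = 0)}" for k
  have V_carrier: "V k \<subseteq> carrier_vec n" for k using car by (auto simp: V_def)
  have AP: "A *\<^sub>v (P *\<^sub>v y) = P *\<^sub>v (B *\<^sub>v y)" if y: "y \<in> carrier_vec n" for y
  proof -
    have "A * P = P * B * (Q * P)" unfolding PQ(3) using car by (simp add: assoc_mult_mat[of _ n n _ n _ n])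
    then have "A * P = P * B" using PQ(2) car by simp
    then show ?thesis
      using assoc_mult_mat_vec[OF A car(2) y] assoc_mult_mat_vec[OF car(2) car(1) y] by simp
  qed
  have By: "(B *\<^sub>v y) $ j = (\<Sum>l\<in>{j..<n}. B $$ (j, l) * y $ l)" if y: "y \<in> carrier_vec n" and j: "j < n" for y j
  proof -
    have "(B *\<^sub>v y) $ j = (\<Sum>l\<in>{0..<n}. B $$ (j, l) * y $ l)"
      using car y j by (simp add: scalar_prod_def)
    also have "\<dots> = (\<Sum>l\<in>{j..<n}. B $$ (j, l) * y $ l)"
      using upper_triangularD[OF ut] car j by (intro sum.mono_neutral_right) auto
    finally show ?thesis .
  qed
  have V_inv: "A *\<^sub>v v \<in> V k" if v: "v \<in> V k" for v k
  proof -
    obtain y where y: "y \<in> carrier_vec n" "\<forall>j<n. k \<le> j \<longrightarrow> y $ j = 0" "v = P *\<^sub>v y"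
      using v by (auto simp: V_def)
    have "\<forall>j<n. k \<le> j \<longrightarrow> (B *\<^sub>v y) $ j = 0" using y by (auto simp: By intro!: sum.neutral)
    then show ?thesis using y car unfolding V_def y(3) AP[OF y(1)] by auto
  qed
  have V_mono: "V k \<subseteq> V l" if "k \<le> l" for k l using that by (force simp: V_def)
  have ex: "\<exists>x. x \<in> V (Suc k) \<and> x \<bullet>c x = 1 \<and> (\<forall>v\<in>V k. x \<bullet>c v = 0)" if k: "k < n" for k
  proof -
    \<comment> \<open>\<open>k\<close> conditions make \<open>x\<close> orthogonal to the flag space
      \<open>V k\<close>, and \<open>n - k - 1\<close> conditions make the coordinates of
      \<open>Q x\<close> after position \<open>k\<close> vanish: \<open>n - 1\<close> in
      total.\<close>
    define ws where "ws = map (col P) [0..<k] @ map (\<lambda>j. conjugate (row Q j)) [Suc k..<n]"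
    have "set ws \<subseteq> carrier_vec n" "length ws < n"
      using k car by (auto simp: ws_def)
    then obtain x where x: "x \<in> carrier_vec n" "x \<bullet>c x = 1" "\<And>w. w \<in> set ws \<Longrightarrow> x \<bullet>c w = 0"
      using orthogonal_unit_vec by blast
    have "x = P *\<^sub>v (Q *\<^sub>v x)"
      using PQ(1) x(1) assoc_mult_mat_vec[OF car(2) car(3) x(1)] by simp
    moreover have "(Q *\<^sub>v x) $ j = 0" if j: "j < n" "Suc k \<le> j" for j
    proof -
      have "conjugate (row Q j) \<in> set ws" using j by (auto simp: ws_def)
      from x(3)[OF this] show ?thesis
        using j car x(1) comm_scalar_prod[of "row Q j" n x] by simp
    qed
    moreover have "Q *\<^sub>v x \<in> carrier_vec n" using car x(1) by simp
    ultimately have "x \<in> V (Suc k)" unfolding V_def by blast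
    moreover have "x \<bullet>c v = 0" if v: "v \<in> V k" for v
    proof -
      obtain y where y: "y \<in> carrier_vec n" "\<forall>j<n. k \<le> j \<longrightarrow> y $ j = 0" "v = P *\<^sub>v y"
        using v by (auto simp: V_def)
      have "x \<bullet>c v = (\<Sum>a<n. x $ a * cnj (\<Sum>l<n. P $$ (a, l) * y $ l))"
        using car y(1,3) by (simp add: cscalar_sum[of _ n] scalar_prod_def atLeast0LessThan)
      also have "\<dots> = (\<Sum>l<n. \<Sum>a<n. cnj (y $ l) * (x $ a * cnj (P $$ (a, l))))"
        by (subst sum.swap) (simp add: sum_distrib_left mult_ac)
      also have "\<dots> = (\<Sum>l<n. cnj (y $ l) * (x \<bullet>c col P l))"
        using car by (simp add: cscalar_sum[of _ n] sum_distrib_left)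
      also have "\<dots> = 0"
      proof (intro sum.neutral ballI)
        fix l assume "l \<in> {..<n}"
        then show "cnj (y $ l) * (x \<bullet>c col P l) = 0"
          using y(2) x(3)[of "col P l"] by (cases "l < k") (auto simp: ws_def)
      qed
      finally show ?thesis .
    qed
    ultimately show ?thesis using x(2) by blast
  qed
  define h where "h i = (SOME x. x \<in> V i \<and> x \<bullet>c x = 1 \<and> (\<forall>v\<in>V (i - 1). x \<bullet>c v = 0))" for i
  have h: "h i \<in> V i" "h i \<bullet>c h i = 1" "\<And>v. v \<in> V (i - 1) \<Longrightarrow> h i \<bullet>c v = 0" if i: "i \<in> {1..n}" for i
    using someI_ex[OF ex[of "i - 1"]] i unfolding h_def by auto
  have hc: "h i \<in> carrier_vec n" if "i \<in> {1..n}" for i using h(1)[OF that] V_carrier by auto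
  have less: "h j \<bullet>c h i = 0" if "i < j" "i \<in> {1..n}" "j \<in> {1..n}" for i j
    using h(1)[OF that(2)] h(3)[OF that(3)] V_mono[of i "j - 1"] that(1) by (simp add: subset_iff)
  have "h i \<bullet>c h j = (if i = j then 1 else 0)" if ij: "i \<in> {1..n}" "j \<in> {1..n}" for i j
    using less[of i j] less[of j i] ij h(2) cscalar_cnj[OF hc[OF ij(2)] hc[OF ij(1)]]
    by (cases i j rule: linorder_cases) auto
  moreover have "A *\<^sub>v h i = complex_of_real (eigval A i) \<cdot>\<^sub>v h i" if i: "i \<in> {1..n}" for i
  proof -
    obtain k where k: "i = Suc k" "k < n" using i by (cases i) auto
    define e where "e = complex_of_real (eigval A i)"
    have e: "B $$ (k, k) = e"
      using arg_cong[OF diag, of "\<lambda>xs. xs ! k"] k car es[OF k(2)] len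
      by (simp add: diag_mat_def e_def)
    obtain y where y: "y \<in> carrier_vec n" "\<forall>j<n. Suc k \<le> j \<longrightarrow> y $ j = 0" "h i = P *\<^sub>v y"
      using h(1)[OF i] k by (auto simp: V_def)
    \<comment> \<open>Subtracting \<open>e\<close>, the diagonal entry of \<open>B\<close> at
      \<open>k\<close>, also kills coordinate \<open>k\<close>, so \<open>w = A h i - e h i\<close>
      lies in \<open>V k\<close>. Both \<open>w\<close> and \<open>A w\<close> are therefore
      orthogonal to \<open>h i\<close>, which forces \<open>w\<close> to have norm zero.\<close>
    define z where "z = B *\<^sub>v y - e \<cdot>\<^sub>v y"
    have z: "z \<in> carrier_vec n" using car y by (simp add: z_def)
    have "z $ j = 0" if j: "j < n" "k \<le> j" for j
    proof -
      have "(B *\<^sub>v y) $ j = (\<Sum>l\<in>{j..<n}. if l = k then B $$ (j, l) * y $ l else 0)"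
        unfolding By[OF y(1) j(1)] using y(2) j by (intro sum.cong) (auto simp: not_le)
      also have "\<dots> = (if j = k then e * y $ k else 0)" using j e by auto
      finally show ?thesis using y j car by (auto simp: z_def)
    qed
    then have wV: "P *\<^sub>v z \<in> V k" using z unfolding V_def by blast
    define w where "w = P *\<^sub>v z"
    have w: "w \<in> carrier_vec n" using car z by (simp add: w_def)
    have weq: "w = A *\<^sub>v h i - e \<cdot>\<^sub>v h i"
      using car y unfolding w_def z_def y(3) AP[OF y(1)]
      by (simp add: mult_minus_distrib_mat_vec[of _ n n] mult_mat_vec)
    have "w \<bullet>c w = (A *\<^sub>v h i) \<bullet>c w - e * (h i \<bullet>c w)"
      using w A hc[OF i] unfolding weq
      by (simp add: minus_scalar_prod_distrib[of _ n] cscalar_smult[of _ n])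
    also have "(A *\<^sub>v h i) \<bullet>c w = h i \<bullet>c (A *\<^sub>v w)"
      using cscalar_adjoint[OF A hc[OF i] w] her by simp
    also have "h i \<bullet>c (A *\<^sub>v w) = 0" using h(3)[OF i] V_inv[OF wV] k by (simp add: w_def)
    also have "h i \<bullet>c w = 0" using h(3)[OF i] wV k by (simp add: w_def)
    finally have "w = 0\<^sub>v n" using cscalar_self_eq_0[OF w] by simp
    then have "(A *\<^sub>v h i) $ a - (e \<cdot>\<^sub>v h i) $ a = 0" if "a < n" for a
      using weq that hc[OF i] A by (metis index_minus_vec(1) index_zero_vec(1) carrier_vecD index_smult_vec(2))
    then show ?thesis unfolding e_def[symmetric] using A hc[OF i] by (intro eq_vecI) auto
  qed
  ultimately show ?thesis using that[of h] hc by (simp add: eigen_onb_def)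
qed

subsection \<open>Convexity and water filling\<close>

definition strictly_convex :: "(real \<Rightarrow> real) \<Rightarrow> bool" where
  "strictly_convex f \<longleftrightarrow> (\<forall>x y u. 0 \<le> x \<longrightarrow> 0 \<le> y \<longrightarrow> x \<noteq> y \<longrightarrow> 0 < u \<longrightarrow> u < 1 \<longrightarrow>
     f ((1 - u) * x + u * y) < (1 - u) * f x + u * f y)"

lemma strictly_convexD:
  "strictly_convex f \<Longrightarrow> 0 \<le> x \<Longrightarrow> 0 \<le> y \<Longrightarrow> x \<noteq> y \<Longrightarrow> 0 < u \<Longrightarrow> u < 1 \<Longrightarrow>
     f ((1 - u) * x + u * y) < (1 - u) * f x + u * f y"
  unfolding strictly_convex_def by blast

text \<open>The slope is the supremum of the chord slopes to the left of \<open>c\<close>, which the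
  chord slopes to the right bound from above. Left chords exist because \<open>c\<close> is
  positive. Strictness follows at the midpoint of \<open>c\<close> and \<open>y\<close>: were the
  line touched at \<open>y\<close>, \<open>f\<close> would fall below it there.\<close>

lemma strictly_convex_support:
  assumes f: "strictly_convex f" and c: "0 < c"
  obtains s where "\<And>y. 0 \<le> y \<Longrightarrow> y \<noteq> c \<Longrightarrow> f c + s * (y - c) < f y"
proof -
  define L where "L x = (f c - f x) / (c - x)" for x
  define s where "s = Sup (L ` {0..<c})"
  have slopes: "L x \<le> L y" if x: "0 \<le> x" "x < c" and y: "c < y" for x y
  proof -
    define u where "u = (c - x) / (y - x)"
    have u: "0 < u" "u < 1" using x y by (auto simp: u_def field_simps)
    have uy: "u * (y - x) = c - x" using x y by (simp add: u_def)
    then have "(1 - u) * x + u * y = c" by (simp add: algebra_simps)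
    then have "f c < (1 - u) * f x + u * f y"
      using strictly_convexD[OF f, of x y u] x y u by simp
    then have "(y - x) * f c < (y - x) * ((1 - u) * f x + u * f y)"
      using x y by (intro mult_strict_left_mono) auto
    also have "\<dots> = (y - x) * f x + u * (y - x) * (f y - f x)" by (simp add: algebra_simps)
    also have "\<dots> = (y - x) * f x + (c - x) * (f y - f x)" by (simp only: uy)
    finally have "(f c - f x) * (y - c) < (f y - f c) * (c - x)" by (simp add: algebra_simps)
    moreover have "L y = (f y - f c) / (y - c)"
      unfolding L_def by (metis minus_diff_eq minus_divide_divide)
    ultimately show ?thesis using x y by (simp add: L_def field_simps)
  qed
  have ne: "L ` {0..<c} \<noteq> {}" using c by simp
  have above: "s \<le> L y" if "c < y" for y
    unfolding s_def using slopes that by (intro cSup_least[OF ne]) auto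
  have "bdd_above (L ` {0..<c})" using slopes[of _ "c + 1"] by (intro bdd_aboveI[of _ "L (c + 1)"]) auto
  then have below: "L x \<le> s" if "0 \<le> x" "x < c" for x
    unfolding s_def using that by (intro cSup_upper) auto
  have weak: "f c + s * (y - c) \<le> f y" if y: "0 \<le> y" for y
  proof (cases y c rule: linorder_cases)
    case less
    then show ?thesis using below[OF y less] by (simp add: L_def field_simps)
  next
    case greater
    then show ?thesis using above[OF greater] by (simp add: L_def field_simps)
  qed simp
  have "f c + s * (y - c) < f y" if y: "0 \<le> y" "y \<noteq> c" for y
  proof (rule ccontr)
    assume "\<not> f c + s * (y - c) < f y"
    moreover have "f ((1 - 1/2) * c + 1/2 * y) < (1 - 1/2) * f c + 1/2 * f y"
      using strictly_convexD[OF f, of c y "1/2"] y c by simp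
    moreover have "f c + s * (((1 - 1/2) * c + 1/2 * y) - c) \<le> f ((1 - 1/2) * c + 1/2 * y)"
      using y c by (intro weak) simp
    ultimately show False by (simp add: algebra_simps)
  qed
  then show ?thesis by (rule that)
qed

text \<open>Removing the support line at \<open>c\<close> splits \<open>f\<close> into an increasing part \<open>P\<close>, controlled through
  the lower bounds on the means \<open>\<Sum>j. w i j * mu j\<close>, and a decreasing part \<open>N\<close>, controlled through
  the upper bounds on the means \<open>\<Sum>j. v i j * mu j\<close>.\<close>

lemma water_filling_equality:
  fixes lam mu nu :: "nat \<Rightarrow> real" and w v :: "nat \<Rightarrow> nat \<Rightarrow> real"
  assumes f: "strictly_convex f" and mono: "mono_on {0..} f" and c: "0 < c"
    and I: "finite I"
    and w0: "\<And>i j. 0 \<le> w i j" and w1: "\<And>i. i \<in> I \<Longrightarrow> (\<Sum>j\<in>I. w i j) = 1" "\<And>j. j \<in> I \<Longrightarrow> (\<Sum>i\<in>I. w i j) = 1"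
    and v0: "\<And>i j. 0 \<le> v i j" and v1: "\<And>i. i \<in> I \<Longrightarrow> (\<Sum>j\<in>I. v i j) = 1" "\<And>j. j \<in> I \<Longrightarrow> (\<Sum>i\<in>I. v i j) = 1"
    and mu: "\<And>j. j \<in> I \<Longrightarrow> 0 \<le> mu j" and lam: "\<And>i. i \<in> I \<Longrightarrow> 0 < lam i"
    and upper: "\<And>i. i \<in> I \<Longrightarrow> lam i \<le> (\<Sum>j\<in>I. w i j * mu j)"
    and lower: "\<And>i. i \<in> I \<Longrightarrow> i \<le> M \<Longrightarrow> (\<Sum>j\<in>I. v i j * mu j) \<le> lam i"
    and nu: "\<And>i. i \<in> I \<Longrightarrow> nu i = (if i \<le> M \<and> lam i < c then lam i else max (lam i) c)"
    and tr: "(\<Sum>i\<in>I. nu i) \<le> (\<Sum>j\<in>I. mu j)"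
    and le: "(\<Sum>j\<in>I. f (mu j)) \<le> (\<Sum>i\<in>I. f (nu i))"
  shows "\<And>i. i \<in> I \<Longrightarrow> c < lam i \<Longrightarrow> (\<Sum>j\<in>I. w i j * mu j) = lam i"
    and "\<And>i j. i \<in> I \<Longrightarrow> j \<in> I \<Longrightarrow> lam i \<le> c \<Longrightarrow> w i j \<noteq> 0 \<Longrightarrow> mu j \<le> c"
    and "\<And>i j. i \<in> I \<Longrightarrow> j \<in> I \<Longrightarrow> i \<le> M \<Longrightarrow> lam i < c \<Longrightarrow> v i j \<noteq> 0 \<Longrightarrow> mu j = lam i"
    and "\<And>i j. i \<in> I \<Longrightarrow> j \<in> I \<Longrightarrow> \<not> (i \<le> M \<and> lam i < c) \<Longrightarrow> v i j \<noteq> 0 \<Longrightarrow> c \<le> mu j"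
proof -
  obtain s where s: "\<And>y. 0 \<le> y \<Longrightarrow> y \<noteq> c \<Longrightarrow> f c + s * (y - c) < f y"
    using strictly_convex_support[OF f c] by blast
  \<comment> \<open>Monotonicity of \<open>f\<close> enters here; a positive slope turns the lower
    bound on the trace into a lower bound on the potential.\<close>
  have "0 < s"
  proof -
    have "f 0 \<le> f c" using mono_onD[OF mono, of 0 c] c by simp
    with s[of 0] c have "0 < s * c" by simp
    then show ?thesis using c by (simp add: zero_less_mult_iff)
  qed
  define phi where "phi x = f x - f c - s * (x - c)" for x
  define P where "P x = (if x \<ge> c then phi x else 0)" for x
  define N where "N x = (if x \<le> c then phi x else 0)" for x
  have phi_c: "phi c = 0" by (simp add: phi_def)
  have phi_pos: "0 < phi x" if "0 \<le> x" "x \<noteq> c" for x using s[OF that] by (simp add: phi_def)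
  have PN: "phi x = P x + N x" for x by (cases "x = c") (auto simp: P_def N_def phi_c)
  have "0 \<le> phi x" if "0 \<le> x" for x using phi_pos[OF that] phi_c by (metis order_less_imp_le order_refl)
  then have P0: "0 \<le> P x" and N0: "0 \<le> N x" if "0 \<le> x" for x
    using that by (auto simp: P_def N_def)
  have phi_support: "\<exists>\<sigma>. \<forall>y\<ge>0. y \<noteq> x \<longrightarrow> phi x + \<sigma> * (y - x) < phi y" if x: "0 < x" for x
  proof -
    obtain \<sigma> where "\<And>y. 0 \<le> y \<Longrightarrow> y \<noteq> x \<Longrightarrow> f x + \<sigma> * (y - x) < f y"
      using strictly_convex_support[OF f x] by blast
    then show ?thesis by (intro exI[of _ "\<sigma> - s"]) (auto simp: phi_def algebra_simps)
  qed
  \<comment> \<open>The slope is positive since \<open>phi\<close> is positive at \<open>x\<close>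
    and zero at \<open>c\<close>. To the left of \<open>c\<close>, where \<open>P\<close> vanishes,
    the line is already negative.\<close>
  have P_support: "\<exists>\<sigma>>0. \<forall>y\<ge>0. P x + \<sigma> * (y - x) \<le> P y" if x: "c < x" for x
  proof -
    obtain \<sigma> where \<sigma>: "\<And>y. 0 \<le> y \<Longrightarrow> y \<noteq> x \<Longrightarrow> phi x + \<sigma> * (y - x) < phi y"
      using phi_support[of x] x c by auto
    have "phi x < \<sigma> * (x - c)" using \<sigma>[of c] x c phi_c by (simp add: algebra_simps)
    then have pos: "0 < \<sigma> * (x - c)" using phi_pos[of x] x c by simp
    then have "0 < \<sigma>" using x by (simp add: zero_less_mult_iff)
    moreover have "P x + \<sigma> * (y - x) \<le> P y" if y: "0 \<le> y" for y
    proof (cases "y < c")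
      case True
      then have "\<sigma> * y \<le> \<sigma> * c" using \<open>0 < \<sigma>\<close> by simp
      then show ?thesis using \<open>phi x < \<sigma> * (x - c)\<close> True x by (simp add: P_def algebra_simps)
    next
      case False
      then show ?thesis using \<sigma>[OF y] x by (cases "y = x") (auto simp: P_def)
    qed
    ultimately show ?thesis by blast
  qed
  \<comment> \<open>The mirror image of the previous step, kept strict because equality must later
    force \<open>mu j = lam i\<close>.\<close>
  have N_support: "\<exists>\<sigma>\<le>0. \<forall>y\<ge>0. y \<noteq> x \<longrightarrow> N x + \<sigma> * (y - x) < N y" if x: "0 < x" "x < c" for x
  proof -
    obtain \<sigma> where \<sigma>: "\<And>y. 0 \<le> y \<Longrightarrow> y \<noteq> x \<Longrightarrow> phi x + \<sigma> * (y - x) < phi y"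
      using phi_support[OF x(1)] by auto
    have *: "phi x + \<sigma> * (c - x) < 0" using \<sigma>[of c] x c phi_c by simp
    then have "\<sigma> * (c - x) < 0" using phi_pos[of x] x by simp
    then have "\<sigma> < 0" using x by (simp add: mult_less_0_iff)
    moreover have "N x + \<sigma> * (y - x) < N y" if y: "0 \<le> y" "y \<noteq> x" for y
    proof (cases "c < y")
      case True
      then have "\<sigma> * y \<le> \<sigma> * c" using \<open>\<sigma> < 0\<close> by simp
      then show ?thesis using * True x by (simp add: N_def algebra_simps)
    next
      case False
      then show ?thesis using \<sigma>[OF y] x by (auto simp: N_def)
    qed
    ultimately show ?thesis using less_imp_le by blast
  qed

  \<comment> \<open>\<open>a i\<close> and \<open>b i\<close> are the losses in the estimates for
    \<open>P\<close> and \<open>N\<close>; for \<open>i > M\<close> the part \<open>N\<close> is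
    only bounded below by 0. All losses are nonnegative and their total is at most 0, so each
    vanishes, and the four conclusions are read off.\<close>
  define a where "a i = (\<Sum>j\<in>I. w i j * P (mu j)) - P (lam i)" for i
  define b where "b i = (\<Sum>j\<in>I. v i j * N (mu j)) - (if i \<le> M then N (lam i) else 0)" for i
  have a_gt: "\<exists>\<sigma>>0. \<sigma> * ((\<Sum>j\<in>I. w i j * mu j) - lam i) \<le> a i" if i: "i \<in> I" and gt: "c < lam i" for i
  proof -
    obtain \<sigma> where \<sigma>: "\<sigma> > 0" "\<And>y. 0 \<le> y \<Longrightarrow> P (lam i) + \<sigma> * (y - lam i) \<le> P y"
      using P_support[OF gt] by blast
    have "(\<Sum>j\<in>I. w i j * (P (lam i) + \<sigma> * (mu j - lam i))) \<le> (\<Sum>j\<in>I. w i j * P (mu j))"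
      by (intro sum_mono mult_left_mono \<sigma>(2) mu w0)
    moreover have "(\<Sum>j\<in>I. w i j * (P (lam i) + \<sigma> * (mu j - lam i)))
        = (P (lam i) - \<sigma> * lam i) * (\<Sum>j\<in>I. w i j) + \<sigma> * (\<Sum>j\<in>I. w i j * mu j)"
      unfolding sum_distrib_left sum.distrib[symmetric] by (intro sum.cong) (auto simp: algebra_simps)
    ultimately show ?thesis using \<sigma>(1) w1(1)[OF i] by (intro exI[of _ \<sigma>]) (simp add: a_def algebra_simps)
  qed
  have wP0: "0 \<le> w i j * P (mu j)" and vN0: "0 \<le> v i j * N (mu j)" if "j \<in> I" for i j
    using that by (auto intro!: mult_nonneg_nonneg w0 v0 P0 N0 mu)
  have a0: "0 \<le> a i" if i: "i \<in> I" for i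
  proof (cases "c < lam i")
    case True
    then obtain \<sigma> where "\<sigma> > 0" "\<sigma> * ((\<Sum>j\<in>I. w i j * mu j) - lam i) \<le> a i" using a_gt[OF i] by blast
    moreover have "0 \<le> \<sigma> * ((\<Sum>j\<in>I. w i j * mu j) - lam i)"
      using \<open>\<sigma> > 0\<close> upper[OF i] by simp
    ultimately show ?thesis by linarith
  next
    case False
    then have "P (lam i) = 0" using phi_c by (cases "lam i = c") (simp_all add: P_def)
    then show ?thesis unfolding a_def using wP0 by (simp add: sum_nonneg)
  qed
  \<comment> \<open>The weighted mean of \<open>mu\<close> is at most \<open>lam i\<close> and the
    slope is at most 0, so the linear term only helps. With a support line of \<open>N\<close>, the
    left side has nonnegative summands, and \<open>b i = 0\<close> kills each of them.\<close>
  have b_lt: "(\<Sum>j\<in>I. v i j * (N (mu j) - (N (lam i) + \<sigma> * (mu j - lam i)))) \<le> b i"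
    if i: "i \<in> I" "i \<le> M" and \<sigma>: "\<sigma> \<le> 0" for i \<sigma>
  proof -
    have "(\<Sum>j\<in>I. v i j * (N (mu j) - (N (lam i) + \<sigma> * (mu j - lam i))))
        = (\<Sum>j\<in>I. v i j * N (mu j)) - ((N (lam i) - \<sigma> * lam i) * (\<Sum>j\<in>I. v i j) + \<sigma> * (\<Sum>j\<in>I. v i j * mu j))"
      unfolding sum_distrib_left sum.distrib[symmetric] sum_subtractf[symmetric]
      by (intro sum.cong) (auto simp: algebra_simps)
    also have "\<dots> = b i - \<sigma> * ((\<Sum>j\<in>I. v i j * mu j) - lam i)"
      using i v1(1)[OF i(1)] by (simp add: b_def algebra_simps)
    also have "\<dots> \<le> b i"
      using \<sigma> lower[OF i] by (simp add: mult_nonpos_nonpos)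
    finally show ?thesis .
  qed
  have N_zero: "N x = 0" if "c \<le> x" for x using that by (auto simp: N_def phi_c)
  have b0: "0 \<le> b i" if i: "i \<in> I" for i
  proof (cases "i \<le> M \<and> lam i < c")
    case True
    then obtain \<sigma> where \<sigma>: "\<sigma> \<le> 0" "\<And>y. 0 \<le> y \<Longrightarrow> y \<noteq> lam i \<Longrightarrow> N (lam i) + \<sigma> * (y - lam i) < N y"
      using N_support[OF lam[OF i]] by blast
    have "0 \<le> (\<Sum>j\<in>I. v i j * (N (mu j) - (N (lam i) + \<sigma> * (mu j - lam i))))"
    proof (intro sum_nonneg mult_nonneg_nonneg v0)
      fix j assume "j \<in> I"
      then show "0 \<le> N (mu j) - (N (lam i) + \<sigma> * (mu j - lam i))"
        using \<sigma>(2)[OF mu[of j]] by (cases "mu j = lam i") auto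
    qed
    then show ?thesis using b_lt[OF i _ \<sigma>(1)] True by linarith
  next
    case False
    then show ?thesis unfolding b_def using vN0 by (auto intro!: sum_nonneg simp: N_zero)
  qed
  have "(\<Sum>i\<in>I. a i) + (\<Sum>i\<in>I. b i) \<le> 0"
  proof -
    have wP: "(\<Sum>i\<in>I. \<Sum>j\<in>I. w i j * P (mu j)) = (\<Sum>j\<in>I. P (mu j))"
      by (subst sum.swap) (simp add: sum_distrib_right[symmetric] w1(2))
    have vN: "(\<Sum>i\<in>I. \<Sum>j\<in>I. v i j * N (mu j)) = (\<Sum>j\<in>I. N (mu j))"
      by (subst sum.swap) (simp add: sum_distrib_right[symmetric] v1(2))
    \<comment> \<open>This is what dictates the form of \<open>nu\<close>: an eigenvalue below
      \<open>c\<close> contributes its \<open>N\<close> value if its index is constrained, and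
      otherwise moves to \<open>c\<close>, where \<open>phi\<close> vanishes.\<close>
    have phi_nu: "phi (nu i) = P (lam i) + (if i \<le> M then N (lam i) else 0)" if "i \<in> I" for i
      using nu[OF that] by (cases "lam i" c rule: linorder_cases) (simp_all add: P_def N_def phi_c)
    have "(\<Sum>i\<in>I. a i) + (\<Sum>i\<in>I. b i) = (\<Sum>j\<in>I. phi (mu j)) - (\<Sum>i\<in>I. phi (nu i))"
      unfolding a_def b_def sum_subtractf wP vN PN[of "mu _"] sum.distrib
      by (simp add: phi_nu sum.distrib)
    also have "\<dots> = ((\<Sum>j\<in>I. f (mu j)) - (\<Sum>i\<in>I. f (nu i))) - s * ((\<Sum>j\<in>I. mu j) - (\<Sum>i\<in>I. nu i))"
      unfolding phi_def
      by (simp add: sum_subtractf sum_distrib_left[symmetric] algebra_simps)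
    also have "\<dots> \<le> 0" using le tr \<open>0 < s\<close> by (smt (verit) mult_nonneg_nonneg)
    finally show ?thesis .
  qed
  moreover have "0 \<le> (\<Sum>i\<in>I. a i)" "0 \<le> (\<Sum>i\<in>I. b i)" using a0 b0 by (auto intro: sum_nonneg)
  ultimately have "(\<Sum>i\<in>I. a i) = 0" "(\<Sum>i\<in>I. b i) = 0" by auto
  then have az: "a i = 0" and bz: "b i = 0" if "i \<in> I" for i
    using that a0 b0 I by (simp_all add: sum_nonneg_eq_0_iff)
  show "(\<Sum>j\<in>I. w i j * mu j) = lam i" if i: "i \<in> I" "c < lam i" for i
  proof -
    obtain \<sigma> where "\<sigma> > 0" "\<sigma> * ((\<Sum>j\<in>I. w i j * mu j) - lam i) \<le> 0"
      using a_gt[OF i] az[OF i(1)] by auto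
    then have "(\<Sum>j\<in>I. w i j * mu j) \<le> lam i" by (simp add: mult_le_0_iff)
    then show ?thesis using upper[OF i(1)] by simp
  qed
  show "mu j \<le> c" if "i \<in> I" "j \<in> I" "lam i \<le> c" "w i j \<noteq> 0" for i j
  proof (rule ccontr)
    assume "\<not> mu j \<le> c"
    then have "0 < P (mu j)" using phi_pos[of "mu j"] c by (simp add: P_def)
    moreover have "(\<Sum>j\<in>I. w i j * P (mu j)) = 0"
      using az[OF that(1)] that(3) phi_c by (cases "lam i = c") (simp_all add: a_def P_def)
    ultimately show False
      using that(2,4) I wP0 by (auto simp: sum_nonneg_eq_0_iff)
  qed
  show "c \<le> mu j" if "i \<in> I" "j \<in> I" "\<not> (i \<le> M \<and> lam i < c)" "v i j \<noteq> 0" for i j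
  proof (rule ccontr)
    assume "\<not> c \<le> mu j"
    then have "0 < N (mu j)" using phi_pos[of "mu j"] mu[OF that(2)] by (simp add: N_def)
    moreover have "(\<Sum>j\<in>I. v i j * N (mu j)) = 0"
      using bz[OF that(1)] that(3) by (auto simp: b_def N_zero split: if_splits)
    ultimately show False
      using that(2,4) I vN0 by (auto simp: sum_nonneg_eq_0_iff)
  qed
  show "mu j = lam i" if ij: "i \<in> I" "j \<in> I" "i \<le> M" "lam i < c" "v i j \<noteq> 0" for i j
  proof (rule ccontr)
    assume ne: "mu j \<noteq> lam i"
    obtain \<sigma> where \<sigma>: "\<sigma> \<le> 0" "\<And>y. 0 \<le> y \<Longrightarrow> y \<noteq> lam i \<Longrightarrow> N (lam i) + \<sigma> * (y - lam i) < N y"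
      using N_support[OF lam[OF ij(1)] ij(4)] by blast
    let ?g = "\<lambda>j. v i j * (N (mu j) - (N (lam i) + \<sigma> * (mu j - lam i)))"
    have nonneg: "0 \<le> ?g k" if "k \<in> I" for k
      using \<sigma>(2)[OF mu[OF that]] v0[of i k] by (cases "mu k = lam i") (auto intro: mult_nonneg_nonneg)
    moreover have "(\<Sum>j\<in>I. ?g j) \<le> 0" using b_lt[OF ij(1,3) \<sigma>(1)] bz[OF ij(1)] by simp
    ultimately have "(\<Sum>j\<in>I. ?g j) = 0" by (simp add: sum_nonneg order_antisym)
    then have "?g j = 0" using nonneg I ij(2) by (simp add: sum_nonneg_eq_0_iff)
    then show False using ij(5) \<sigma>(2)[OF mu[OF ij(2)] ne] by simp
  qed
qed

text \<open>The index \<open>d - 1\<close> always qualifies because \<open>t\<close> is at least the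
  full sum, so the minimum exists. Failure at the preceding index, rearranged, says that the level
  lies strictly below the last retained entry.\<close>

lemma r_lam_props:
  assumes d: "1 \<le> d" and t: "(\<Sum>i=1..d. lam i) \<le> t"
  shows "r_lam d lam t < d" "lam (r_lam d lam t + 1) \<le> c_lam d lam t"
    "i \<in> {1..r_lam d lam t} \<Longrightarrow> (\<And>i j. 1 \<le> i \<Longrightarrow> i \<le> j \<Longrightarrow> j \<le> d \<Longrightarrow> lam j \<le> lam i) \<Longrightarrow> c_lam d lam t < lam i"
    "(\<Sum>i=1..r_lam d lam t. lam i) + (real d - real (r_lam d lam t)) * c_lam d lam t = t"
proof -
  let ?Q = "\<lambda>q. q < d \<and> lam (q + 1) \<le> p_lam d lam q t"
  have "(\<Sum>i=1..d. lam i) = (\<Sum>i=1..d-1. lam i) + lam d"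
    using d by (cases d) auto
  then have "?Q (d - 1)" using d t by (simp add: p_lam_def of_nat_diff)
  then have r: "?Q (r_lam d lam t)" unfolding r_lam_def by (rule LeastI)
  then show rd: "r_lam d lam t < d" and "lam (r_lam d lam t + 1) \<le> c_lam d lam t"
    by (auto simp: c_lam_def)
  show eq: "(\<Sum>i=1..r_lam d lam t. lam i) + (real d - real (r_lam d lam t)) * c_lam d lam t = t"
    using rd by (simp add: c_lam_def p_lam_def)
  assume i: "i \<in> {1..r_lam d lam t}"
    and dec: "\<And>i j. 1 \<le> i \<Longrightarrow> i \<le> j \<Longrightarrow> j \<le> d \<Longrightarrow> lam j \<le> lam i"
  obtain q where q: "r_lam d lam t = Suc q" using i by (cases "r_lam d lam t") auto
  have "\<not> ?Q q" using q not_less_Least[of q ?Q] unfolding r_lam_def by simp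
  then have "p_lam d lam q t < lam (Suc q)" using q rd by simp
  then have "t - (\<Sum>j=1..q. lam j) < lam (Suc q) * (real d - real q)"
    using q rd by (simp add: p_lam_def pos_divide_less_eq)
  then have "(real d - real (Suc q)) * c_lam d lam t < (real d - real (Suc q)) * lam (Suc q)"
    using eq unfolding q by (simp add: algebra_simps)
  moreover have "0 < real d - real (Suc q)" using q rd by simp
  ultimately have "c_lam d lam t < lam (Suc q)" by (metis mult_less_cancel_left_pos)
  also have "\<dots> \<le> lam i" using i q rd by (intro dec) auto
  finally show "c_lam d lam t < lam i" .
qed

text \<open>The eigenvalues of the minimizers, as a vector: the water-filling level \<open>c\<close> is imposed on
  the indices after \<open>r'\<close>, and \<open>M\<close> is the number of rank constraints that are active.\<close>

lemma water_filling_level: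
  fixes lam :: "nat \<Rightarrow> real" and m :: int
  assumes d: "1 \<le> d" and t: "(\<Sum>i=1..d. lam i) \<le> t"
    and pos: "\<And>i. i \<in> {1..d} \<Longrightarrow> 0 < lam i"
    and dec: "\<And>i j. 1 \<le> i \<Longrightarrow> i \<le> j \<Longrightarrow> j \<le> d \<Longrightarrow> lam j \<le> lam i"
    and m: "m < int d"
  defines "c \<equiv> c_lam_m d lam m t" and "R \<equiv> nat (max (int (r_lam_m d lam m t)) m)"
  obtains M where "M = 0 \<or> 0 < m \<and> M = nat m \<and> s_star d lam (nat m) < t" "0 < c" "R < d" "m \<le> int R"
    "\<And>i. i \<in> {1..R} \<Longrightarrow> (if i \<le> M \<and> lam i < c then lam i else max (lam i) c) = lam i"
    "\<And>i. i \<in> {R<..d} \<Longrightarrow> (if i \<le> M \<and> lam i < c then lam i else max (lam i) c) = c"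
    "(\<Sum>i=1..d. if i \<le> M \<and> lam i < c then lam i else max (lam i) c) = t"
proof -
  have split_sum: "(\<Sum>i=1..d. g i) = (\<Sum>i=1..k. g i) + (\<Sum>i\<in>{k<..d}. g i)" if "k \<le> d" for g :: "nat \<Rightarrow> real" and k
  proof -
    have "{1..d} = {1..k} \<union> {k<..d}" using that by auto
    then show ?thesis by (simp add: sum.union_disjoint ivl_disj_int)
  qed
  have fill: "(\<Sum>i=1..d. nu i) = t"
    if "k \<le> d" "\<And>i. i \<in> {1..k} \<Longrightarrow> nu i = lam i" "\<And>i. i \<in> {k<..d} \<Longrightarrow> nu i = c"
      "(\<Sum>i=1..k. lam i) + (real d - real k) * c = t" for nu k
  proof -
    have "(\<Sum>i=1..k. nu i) = (\<Sum>i=1..k. lam i)" using that(2) by (intro sum.cong) auto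
    moreover have "(\<Sum>i\<in>{k<..d}. nu i) = (real d - real k) * c"
      using that(1,3) by (simp add: of_nat_diff)
    ultimately show ?thesis using split_sum[OF that(1), of nu] that(4) by simp
  qed
  show thesis
  proof (cases "m \<le> 0 \<or> t \<le> s_star d lam (nat m)")
    case True
    define r where "r = r_lam d lam t"
    have c: "c = c_lam d lam t" using True by (simp add: c_def c_lam_m_def)
    note r = r_lam_props[OF d t, folded r_def c]
    have r3: "c < lam i" if "i \<in> {1..r}" for i using r(3)[OF that dec] .
    have rm: "r_lam_m d lam m t = r"
    proof (cases "m \<le> 0")
      case False
      have "(LEAST q. q < d \<and> lam (q + 1) \<le> c) = r"
      proof (rule Least_equality)
        fix q assume q: "q < d \<and> lam (q + 1) \<le> c"
        show "r \<le> q" using r3[of "q + 1"] q by (rule_tac ccontr) simp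
      qed (use r in auto)
      then show ?thesis using False by (simp add: r_lam_m_def c_def)
    qed (simp add: r_lam_m_def r_def)
    have R: "R = max r (nat m)" by (simp add: R_def rm) 
    have above: "lam i \<le> c" if "i \<in> {r<..d}" for i
      using r(2) dec[of "r + 1" i] that by auto
    \<comment> \<open>Were \<open>c\<close> above \<open>lam m\<close>, then \<open>r < m\<close>,
      and lowering the last \<open>d - m\<close> entries from \<open>c\<close> to
      \<open>lam m\<close> would give \<open>s_star < t\<close>. With \<open>c <= lam m\<close>, the
      entries between \<open>r\<close> and \<open>m\<close> equal \<open>c\<close>, so passing from
      \<open>r\<close> to \<open>R = max r m\<close> changes no value.\<close>
    have cm: "c \<le> lam (nat m)" if m1: "0 < m"
    proof (rule ccontr)
      assume gt: "\<not> c \<le> lam (nat m)"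
      then have rm: "r < nat m" using r3[of "nat m"] m1 by (cases "nat m \<le> r") (auto simp: Suc_le_eq)
      have "{1..nat m} = {1..r} \<union> {r<..nat m}" using rm by auto
      then have "(\<Sum>i=1..nat m. lam i) = (\<Sum>i=1..r. lam i) + (\<Sum>i\<in>{r<..nat m}. lam i)"
        by (simp add: sum.union_disjoint ivl_disj_int)
      also have "(\<Sum>i\<in>{r<..nat m}. lam i) \<le> (\<Sum>i\<in>{r<..nat m}. c)"
        using above m by (intro sum_mono) auto
      also have "\<dots> = (real (nat m) - real r) * c" using rm by (simp add: of_nat_diff)
      finally have "s_star d lam (nat m) \<le> (\<Sum>i=1..r. lam i) + (real (nat m) - real r) * c
          + (real d - real (nat m)) * lam (nat m)"
        by (simp add: s_star_def)
      also have "\<dots> < (\<Sum>i=1..r. lam i) + (real (nat m) - real r) * c + (real d - real (nat m)) * c"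
        using gt m m1 by (simp add: nat_less_iff)
      also have "\<dots> = t" using r(4) by (simp add: algebra_simps)
      finally show False using True m1 by simp
    qed
    have low: "c \<le> lam i" if "i \<in> {1..R}" for i
    proof (cases "i \<le> r")
      case False
      then have "0 < m" "i \<le> nat m" using that R by auto
      then show ?thesis using cm dec[of i "nat m"] that m by (auto simp: nat_le_iff)
    qed (use r3[of i] that in auto)
    show thesis
    proof (rule that[of 0])
      show "0 < c" using r(1,2) pos[of "r + 1"] by simp
      show "R < d" using r(1) m d R by (simp add: nat_less_iff)
      show "m \<le> int R" using R by simp
      show "(\<Sum>i=1..d. if i \<le> 0 \<and> lam i < c then lam i else max (lam i) c) = t"
        using r(1) r3 above by (intro fill[OF _ _ _ r(4)]) (fastforce simp: max_def)+
    next
      fix i assume "i \<in> {1..R}"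
      from low[OF this] show "(if i \<le> 0 \<and> lam i < c then lam i else max (lam i) c) = lam i" by simp
    next
      fix i assume "i \<in> {R<..d}"
      then show "(if i \<le> 0 \<and> lam i < c then lam i else max (lam i) c) = c"
        using above[of i] R by simp
    qed simp
  next
    case False
    define k where "k = nat m"
    have k: "1 \<le> k" "k < d" "m = int k" using False m by (auto simp: k_def)
    have c: "c = lam k + (t - s_star d lam k) / (real d - real k)"
      using False k by (simp add: c_def c_lam_m_def)
    have st: "s_star d lam k < t" using False by (simp add: k_def)
    then have ck: "lam k < c" using k by (simp add: c)
    \<comment> \<open>The level for \<open>t > s_star\<close> is the one at which keeping the first
      \<open>k\<close> entries and setting the remaining ones to \<open>c\<close> gives total
      \<open>t\<close>.\<close>
    have "(real d - real k) * c = (real d - real k) * lam k + (t - s_star d lam k)"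
      using k by (simp add: c field_simps)
    then have eq: "(\<Sum>i=1..k. lam i) + (real d - real k) * c = t"
      by (simp add: s_star_def)
    \<comment> \<open>As \<open>lam k < c\<close>, the threshold index is at most
      \<open>k - 1\<close> (entry \<open>q + 1\<close> is tested at \<open>q\<close>), so the
      maximum defining \<open>R\<close> is attained by \<open>m\<close>.\<close>
    have "(LEAST q. q < d \<and> lam (q + 1) \<le> c) \<le> k - 1"
      using k ck by (intro Least_le) auto
    then have "r_lam_m d lam m t \<le> k - 1"
      using False by (simp add: r_lam_m_def c_def)
    then have R: "R = k" using k by (simp add: R_def)
    have above: "lam i < c" if "i \<in> {k<..d}" for i
      using ck dec[of k i] that k by auto
    show thesis
    proof (rule that[of k])
      show "(\<Sum>i=1..d. if i \<le> k \<and> lam i < c then lam i else max (lam i) c) = t"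
        using k above by (intro fill[OF _ _ _ eq]) (auto simp: max_def not_less dest: less_imp_le)
      show "0 < c" using ck pos[of k] k by simp
    next
      fix i assume "i \<in> {R<..d}"
      then show "(if i \<le> k \<and> lam i < c then lam i else max (lam i) c) = c"
        using above[of i] R by simp
    qed (use k R st in \<open>auto simp: max_def not_less\<close>)
  qed
qed

subsection \<open>Perturbations with a large kernel\<close>

lemma hermitian_cscalar:
  fixes A :: "complex mat"
  assumes "A \<in> carrier_mat d d" "mat_adjoint A = A" "x \<in> carrier_vec d" "y \<in> carrier_vec d"
  shows "(A *\<^sub>v x) \<bullet>c y = x \<bullet>c (A *\<^sub>v y)"
  using cscalar_adjoint[OF assms(1,3,4)] assms(2) by simp

lemma eigenvectors_orthogonal:
  assumes A: "A \<in> carrier_mat d d" "mat_adjoint A = A"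
    and x: "x \<in> carrier_vec d" "A *\<^sub>v x = complex_of_real a \<cdot>\<^sub>v x"
    and y: "y \<in> carrier_vec d" "A *\<^sub>v y = complex_of_real b \<cdot>\<^sub>v y"
    and ne: "a \<noteq> b"
  shows "x \<bullet>c y = 0"
proof -
  have "complex_of_real a * (x \<bullet>c y) = complex_of_real b * (x \<bullet>c y)"
    using hermitian_cscalar[OF A x(1) y(1)] x y by (simp add: cscalar_smult[of _ d])
  then show ?thesis using ne by simp
qed

text \<open>One index \<open>k\<close> is filled at a time. Orthogonality to \<open>g j\<close> for
  \<open>lam j\<close> different from \<open>lam k\<close> puts the new vector into the right
  eigenspace; orthogonality to the chosen \<open>h j\<close> with the same eigenvalue makes it new.
  Each index other than \<open>k\<close> contributes at most one condition, so fewer than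
  \<open>d\<close> arise, and the other chosen vectors are orthogonal automatically.\<close>

lemma eigen_onb_extend:
  assumes A: "A \<in> carrier_mat d d" "mat_adjoint A = A" and g: "eigen_onb d A lam g"
    and I: "I \<subseteq> {1..d}" and u: "\<And>i. i \<in> I \<Longrightarrow> u i \<in> carrier_vec d"
    and orth: "\<And>i j. i \<in> I \<Longrightarrow> j \<in> I \<Longrightarrow> u i \<bullet>c u j = (if i = j then 1 else 0)"
    and ev: "\<And>i. i \<in> I \<Longrightarrow> A *\<^sub>v u i = complex_of_real (lam i) \<cdot>\<^sub>v u i"
  obtains h where "eigen_onb d A lam h" "\<And>i. i \<in> I \<Longrightarrow> h i = u i"
proof -
  define Q where "Q K h \<longleftrightarrow> (\<forall>i\<in>K. h i \<in> carrier_vec d \<and> A *\<^sub>v h i = complex_of_real (lam i) \<cdot>\<^sub>v h i) \<and>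
     (\<forall>i\<in>K. \<forall>j\<in>K. h i \<bullet>c h j = (if i = j then 1 else 0)) \<and> (\<forall>i\<in>I. h i = u i)" for K h
  have "\<exists>h. Q (I \<union> K) h" if "finite K" "K \<subseteq> {1..d} - I" for K
    using that
  proof (induction K)
    case empty
    show ?case using u orth ev by (intro exI[of _ u]) (auto simp: Q_def)
  next
    case (insert k K)
    then obtain h where h: "Q (I \<union> K) h" by auto
    have k: "k \<in> {1..d}" "k \<notin> I \<union> K" using insert by auto
    define J where "J = {j \<in> {1..d} - {k}. lam j \<noteq> lam k \<or> j \<in> I \<union> K}"
    have fJ: "finite J" by (simp add: J_def)
    obtain js where js: "set js = J" "distinct js" using finite_distinct_list[OF fJ] by blast
    have "length js = card J" using js distinct_card by metis
    also have "\<dots> \<le> card ({1..d} - {k})" by (intro card_mono) (auto simp: J_def)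
    also have "\<dots> < d" using k(1) by (simp add: card_Diff_singleton)
    finally have len: "length js < d" .
    define ws where "ws = map (\<lambda>j. if lam j = lam k then h j else g j) js"
    have "set ws \<subseteq> carrier_vec d"
      using h g unfolding ws_def Q_def eigen_onb_def by (auto simp: js(1) J_def)
    then obtain x where x: "x \<in> carrier_vec d" "x \<bullet>c x = 1" and xw: "\<And>w. w \<in> set ws \<Longrightarrow> x \<bullet>c w = 0"
      using orthogonal_unit_vec[of ws d] len by (auto simp: ws_def)
    have xJ: "x \<bullet>c (if lam j = lam k then h j else g j) = 0" if "j \<in> J" for j
      using that xw unfolding ws_def js(1)[symmetric] by auto
    have Ax: "A *\<^sub>v x = complex_of_real (lam k) \<cdot>\<^sub>v x"
    proof (rule eigenvectorI[OF g A(1) x(1)])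
      fix j assume j: "j \<in> {1..d}" "x \<bullet>c g j \<noteq> 0"
      show "lam j = lam k"
      proof (rule ccontr)
        assume ne: "lam j \<noteq> lam k"
        then have "j \<in> J" using j by (auto simp: J_def)
        from xJ[OF this] show False using ne j by simp
      qed
    qed
    have xh: "x \<bullet>c h j = 0" if j: "j \<in> I \<union> K" for j
    proof (cases "lam j = lam k")
      case True
      have "j \<in> J" using j k insert.prems I True by (auto simp: J_def)
      then show ?thesis using xJ[of j] True by simp
    next
      case False
      then show ?thesis
        using h j by (intro eigenvectors_orthogonal[OF A x(1) Ax, of _ "lam j"]) (auto simp: Q_def)
    qed
    have hx: "h j \<bullet>c x = 0" if j: "j \<in> I \<union> K" for j
      using xh[OF j] h j cscalar_cnj[OF x(1), of "h j"] by (auto simp: Q_def)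
    have "Q (I \<union> insert k K) (h(k := x))"
      using h k(2) x Ax xh hx unfolding Q_def by auto
    then show ?case by blast
  qed
  from this[of "{1..d} - I"] obtain h where "Q (I \<union> ({1..d} - I)) h" by auto
  then have "Q {1..d} h" using I by (simp add: Un_absorb1)
  then show ?thesis using that[of h] by (auto simp: Q_def eigen_onb_def)
qed

text \<open>Every vector is an eigenvector of the identity, so the previous extension applies with
  all eigenvalues 1.\<close>

lemma onb_extend:
  assumes g: "onb d g" and I: "I \<subseteq> {1..d}" and u: "\<And>i. i \<in> I \<Longrightarrow> u i \<in> carrier_vec d"
    and orth: "\<And>i j. i \<in> I \<Longrightarrow> j \<in> I \<Longrightarrow> u i \<bullet>c u j = (if i = j then 1 else 0)"
  obtains h where "onb d h" "\<And>i. i \<in> I \<Longrightarrow> h i = u i"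
proof -
  have "eigen_onb d (1\<^sub>m d) (\<lambda>_. 1) g" using g by (auto simp: eigen_onb_iff onb_def)
  from eigen_onb_extend[OF _ _ this I u orth]
  show ?thesis using that u by (auto simp: eigen_onb_iff mat_adjoint_one)
qed

text \<open>The hypothesis on \<open>Z\<close> says that its kernel has dimension at least \<open>M\<close>.\<close>

lemma kernel_flag_onb:
  assumes g: "onb d g" and M: "M \<le> d"
    and ker: "\<And>ws. set ws \<subseteq> carrier_vec d \<Longrightarrow> length ws < M \<Longrightarrow>
      \<exists>u\<in>carrier_vec d. u \<bullet>c u = 1 \<and> Z *\<^sub>v u = 0\<^sub>v n \<and> (\<forall>w\<in>set ws. u \<bullet>c w = 0)"
  obtains u where "onb d u" "\<And>i. i \<in> {1..M} \<Longrightarrow> Z *\<^sub>v u i = 0\<^sub>v n"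
    "\<And>i j. i \<in> {1..M} \<Longrightarrow> j \<in> {1..<i} \<Longrightarrow> u i \<bullet>c g j = 0"
proof -
  define Q where "Q K u \<longleftrightarrow> (\<forall>i\<in>K. u i \<in> carrier_vec d \<and> Z *\<^sub>v u i = 0\<^sub>v n \<and> (\<forall>j\<in>{1..<i}. u i \<bullet>c g j = 0)) \<and>
     (\<forall>i\<in>K. \<forall>j\<in>K. u i \<bullet>c u j = (if i = j then 1 else 0))" for K u
  \<comment> \<open>The vectors are chosen from index \<open>M\<close> downwards: \<open>u i\<close>
    must avoid \<open>i - 1\<close> vectors of \<open>g\<close> and the \<open>M - i\<close> vectors
    already chosen, always \<open>M - 1\<close> conditions. Going upwards would cost
    \<open>2 * (i - 1)\<close>.\<close>
  have "\<exists>u. Q {M - k<..M} u" if "k \<le> M" for k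
    using that
  proof (induction k)
    case 0
    show ?case by (simp add: Q_def)
  next
    case (Suc k)
    then obtain u where u: "Q {M - k<..M} u" by auto
    define i where "i = M - k"
    have i: "1 \<le> i" "i \<le> M" "{M - Suc k<..M} = insert i {i<..M}" "i \<notin> {i<..M}"
      using Suc.prems by (auto simp: i_def)
    define ws where "ws = map g [1..<i] @ map u [Suc i..<Suc M]"
    have "set ws \<subseteq> carrier_vec d" "length ws < M"
      using onbD(1)[OF g] u i M by (auto simp: ws_def Q_def i_def[symmetric] simp del: upt_Suc)
    then obtain x where x: "x \<in> carrier_vec d" "x \<bullet>c x = 1" "Z *\<^sub>v x = 0\<^sub>v n" "\<And>w. w \<in> set ws \<Longrightarrow> x \<bullet>c w = 0"
      using ker[of ws] by blast
    have xu: "x \<bullet>c u j = 0" if "j \<in> {i<..M}" for j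
      using that by (intro x(4)) (auto simp: ws_def simp del: upt_Suc)
    have ux: "u j \<bullet>c x = 0" if j: "j \<in> {i<..M}" for j
      using xu[OF j] u j cscalar_cnj[OF x(1), of "u j"] by (auto simp: Q_def i_def)
    have xg: "x \<bullet>c g j = 0" if "j \<in> {1..<i}" for j
      using that by (intro x(4)) (auto simp: ws_def)
    have "Q (insert i {i<..M}) (u(i := x))"
      using u x xu ux xg unfolding Q_def i_def[symmetric] by auto
    then show ?case unfolding i(3) by blast
  qed
  from this[of M] obtain u where u: "Q {1..M} u"
    by (auto simp: atLeastSucAtMost_greaterThanAtMost)
  have "{1..M} \<subseteq> {1..d}" using M by auto
  moreover have "u i \<in> carrier_vec d" "j \<in> {1..M} \<Longrightarrow> u i \<bullet>c u j = (if i = j then 1 else 0)"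
    if "i \<in> {1..M}" for i j
    using u that unfolding Q_def by blast+
  ultimately obtain h where "onb d h" "\<And>i. i \<in> {1..M} \<Longrightarrow> h i = u i"
    using onb_extend[OF g] by blast
  then show ?thesis using u that[of h] by (auto simp: Q_def)
qed

text \<open>The equality analysis first shows that the \<open>u i\<close> at constrained indices
  below \<open>c\<close> are eigenvectors of both \<open>S\<close> and \<open>A\<close>. Completing
  them to an eigenbasis \<open>h\<close> of \<open>A\<close> and repeating the analysis with
  \<open>h\<close> makes the remaining vectors eigenvectors of \<open>S\<close> as well.\<close>

lemma optimal_perturbation:
  assumes A: "A \<in> carrier_mat d d" "mat_adjoint A = A" and Z: "Z \<in> carrier_mat n d"
    and g: "eigen_onb d A lam g"
    and lam_pos: "\<And>i. i \<in> {1..d} \<Longrightarrow> 0 < lam i"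
    and lam_dec: "\<And>i j. 1 \<le> i \<Longrightarrow> i \<le> j \<Longrightarrow> j \<le> d \<Longrightarrow> lam j \<le> lam i"
    and M: "M \<le> d"
    and ker: "\<And>ws. set ws \<subseteq> carrier_vec d \<Longrightarrow> length ws < M \<Longrightarrow>
      \<exists>u\<in>carrier_vec d. u \<bullet>c u = 1 \<and> Z *\<^sub>v u = 0\<^sub>v n \<and> (\<forall>w\<in>set ws. u \<bullet>c w = 0)"
    and S: "S = A + mat_adjoint Z * Z" and e: "eigen_onb d S mu e"
    and f: "strictly_convex f" "mono_on {0..} f" and c: "0 < c"
    and nu: "\<And>i. i \<in> {1..d} \<Longrightarrow> nu i = (if i \<le> M \<and> lam i < c then lam i else max (lam i) c)"
    and tr: "(\<Sum>i=1..d. nu i) \<le> (\<Sum>i=1..d. mu i)"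
    and le: "(\<Sum>i=1..d. f (mu i)) \<le> (\<Sum>i=1..d. f (nu i))"
  obtains h where "eigen_onb d A lam h" "eigen_onb d S nu h"
proof -
  note Z' = mat_adjoint_carrier[OF Z]
  have Sc: "S \<in> carrier_mat d d" using A Z Z' by (simp add: S)
  have Sx: "S *\<^sub>v x = A *\<^sub>v x + mat_adjoint Z *\<^sub>v (Z *\<^sub>v x)" if "x \<in> carrier_vec d" for x
    using A Z Z' that unfolding S
    by (simp add: add_mult_distrib_mat_vec[of _ d d] assoc_mult_mat_vec[of _ d n _ d])
  have Skers: "S *\<^sub>v x = A *\<^sub>v x" if "x \<in> carrier_vec d" "Z *\<^sub>v x = 0\<^sub>v n" for x
  proof -
    have "mat_adjoint Z *\<^sub>v 0\<^sub>v n = 0\<^sub>v d" using Z' by (intro eq_vecI) auto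
    then show ?thesis using Sx[OF that(1)] that A by simp
  qed
  have Sq: "(S *\<^sub>v x) \<bullet>c x = (A *\<^sub>v x) \<bullet>c x + (Z *\<^sub>v x) \<bullet>c (Z *\<^sub>v x)" if x: "x \<in> carrier_vec d" for x
  proof -
    have "(mat_adjoint Z *\<^sub>v (Z *\<^sub>v x)) \<bullet>c x = (Z *\<^sub>v x) \<bullet>c (Z *\<^sub>v x)"
      using cscalar_adjoint[OF Z' _ x, of "Z *\<^sub>v x"] Z x by (simp add: mat_adjoint_adjoint[OF Z])
    then show ?thesis using Sx[OF x] A Z Z' x by (simp add: add_scalar_prod_distrib[of _ d])
  qed
  define nZ where "nZ x = (\<Sum>a<n. (cmod ((Z *\<^sub>v x) $ a))\<^sup>2)" for x
  have nZ: "(Z *\<^sub>v x) \<bullet>c (Z *\<^sub>v x) = complex_of_real (nZ x)" "0 \<le> nZ x"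
    "nZ x = 0 \<Longrightarrow> Z *\<^sub>v x = 0\<^sub>v n" if "x \<in> carrier_vec d" for x
  proof -
    have Zx: "Z *\<^sub>v x \<in> carrier_vec n" using Z that by simp
    show "0 \<le> nZ x" by (auto simp: nZ_def intro: sum_nonneg)
    show eq: "(Z *\<^sub>v x) \<bullet>c (Z *\<^sub>v x) = complex_of_real (nZ x)"
      using cscalar_self[OF Zx] by (simp only: nZ_def)
    show "nZ x = 0 \<Longrightarrow> Z *\<^sub>v x = 0\<^sub>v n" using eq cscalar_self_eq_0[OF Zx] by simp
  qed
  have go: "onb d g" and eo: "onb d e" using g e by (auto simp: eigen_onb_iff)
  let ?q = "\<lambda>x. \<Sum>j=1..d. (cmod (x \<bullet>c e j))\<^sup>2 * mu j"
  have q: "?q x = (\<Sum>j=1..d. (cmod (x \<bullet>c g j))\<^sup>2 * lam j) + nZ x" if x: "x \<in> carrier_vec d" for x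
    using Sq[OF x] unfolding eigen_quadratic_form[OF e Sc x] eigen_quadratic_form[OF g A(1) x] nZ(1)[OF x]
    by (simp only: of_real_add[symmetric] of_real_eq_iff)
  have q_eigen: "?q x = lam i + nZ x"
    if x: "x \<in> carrier_vec d" "x \<bullet>c x = 1" "A *\<^sub>v x = complex_of_real (lam i) \<cdot>\<^sub>v x" for x i
  proof -
    have "complex_of_real (?q x) = complex_of_real (lam i + nZ x)"
      using Sq[OF x(1)] x unfolding eigen_quadratic_form[OF e Sc x(1)] nZ(1)[OF x(1)]
      by (simp add: cscalar_smult[of _ d])
    then show ?thesis by (simp only: of_real_eq_iff)
  qed
  have lam_weights: "lam i \<ge> (\<Sum>j=1..d. (cmod (x \<bullet>c g j))\<^sup>2 * lam j)"
    if x: "x \<in> carrier_vec d" "x \<bullet>c x = 1" and i: "i \<in> {1..d}" and orth: "\<And>j. j \<in> {1..<i} \<Longrightarrow> x \<bullet>c g j = 0" for x i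
  proof -
    have "(\<Sum>j=1..d. (cmod (x \<bullet>c g j))\<^sup>2 * lam j) \<le> (\<Sum>j=1..d. (cmod (x \<bullet>c g j))\<^sup>2 * lam i)"
    proof (intro sum_mono)
      fix j assume "j \<in> {1..d}"
      then show "(cmod (x \<bullet>c g j))\<^sup>2 * lam j \<le> (cmod (x \<bullet>c g j))\<^sup>2 * lam i"
        using lam_dec[of i j] i orth[of j] by (cases "j < i") (auto intro: mult_left_mono)
    qed
    then show ?thesis using onb_weights[OF go x] by (simp add: sum_distrib_right[symmetric])
  qed
  have mu0: "0 \<le> mu j" if j: "j \<in> {1..d}" for j
  proof -
    have ej: "e j \<in> carrier_vec d" using onbD(1)[OF eo j] .
    have "mu j = ?q (e j)"
    proof -
      have "?q (e j) = (\<Sum>i=1..d. if i = j then mu i else 0)"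
        using onbD(2)[OF eo j] by (intro sum.cong) auto
      then show ?thesis using j by simp
    qed
    also have "\<dots> \<ge> 0"
      unfolding q[OF ej] using nZ(2)[OF ej] lam_pos
      by (intro add_nonneg_nonneg sum_nonneg mult_nonneg_nonneg) (auto intro: less_imp_le)
    finally show ?thesis .
  qed

  obtain u where u: "onb d u" "\<And>i. i \<in> {1..M} \<Longrightarrow> Z *\<^sub>v u i = 0\<^sub>v n"
    "\<And>i j. i \<in> {1..M} \<Longrightarrow> j \<in> {1..<i} \<Longrightarrow> u i \<bullet>c g j = 0"
    using kernel_flag_onb[OF go M ker] by metis
  have unit: "x i \<in> carrier_vec d" "x i \<bullet>c x i = 1" if "onb d x" "i \<in> {1..d}" for x i
    using onbD[OF that] that(2) by auto
  have rows: "(\<Sum>j=1..d. (cmod (x i \<bullet>c e j))\<^sup>2) = 1" if "onb d x" "i \<in> {1..d}" for x i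
    using onb_weights[OF eo unit[OF that]] .
  have cols: "(\<Sum>i=1..d. (cmod (x i \<bullet>c e j))\<^sup>2) = 1" if "onb d x" "j \<in> {1..d}" for x j
  proof -
    have "cmod (x i \<bullet>c e j) = cmod (e j \<bullet>c x i)" if "i \<in> {1..d}" for i
      using cscalar_cnj[OF unit(1)[OF \<open>onb d x\<close> that] unit(1)[OF eo \<open>j \<in> {1..d}\<close>]]
      by (metis complex_mod_cnj)
    then show ?thesis using onb_weights[OF that(1) unit[OF eo that(2)]] by simp
  qed
  have u_lower: "?q (u i) \<le> lam i" if i: "i \<in> {1..d}" "i \<le> M" for i
  proof -
    have "nZ (u i) = 0" using u(2)[of i] i by (auto simp: nZ_def)
    then show ?thesis using q[OF unit(1)[OF u(1) i(1)]] lam_weights[OF unit[OF u(1) i(1)] i(1)] u(3)[of i] i by simp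
  qed
  \<comment> \<open>Stated for an arbitrary eigenbasis of \<open>A\<close>, since it is used first
    with \<open>g\<close> and then with the basis \<open>h\<close> adapted to
    \<open>u\<close>.\<close>
  have eq_case:
    "\<And>i. i \<in> {1..d} \<Longrightarrow> c < lam i \<Longrightarrow> ?q (h i) = lam i"
    "\<And>i j. i \<in> {1..d} \<Longrightarrow> j \<in> {1..d} \<Longrightarrow> lam i \<le> c \<Longrightarrow> h i \<bullet>c e j \<noteq> 0 \<Longrightarrow> mu j \<le> c"
    "\<And>i j. i \<in> {1..d} \<Longrightarrow> j \<in> {1..d} \<Longrightarrow> i \<le> M \<Longrightarrow> lam i < c \<Longrightarrow> u i \<bullet>c e j \<noteq> 0 \<Longrightarrow> mu j = lam i"
    "\<And>i j. i \<in> {1..d} \<Longrightarrow> j \<in> {1..d} \<Longrightarrow> \<not> (i \<le> M \<and> lam i < c) \<Longrightarrow> u i \<bullet>c e j \<noteq> 0 \<Longrightarrow> c \<le> mu j"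
    if h: "eigen_onb d A lam h" for h
  proof -
    have ho: "onb d h" using h by (simp add: eigen_onb_iff)
    have upper: "lam i \<le> ?q (h i)" if i: "i \<in> {1..d}" for i
      using q_eigen[OF unit[OF ho i], of i] h i nZ(2)[OF unit(1)[OF ho i]] by (simp add: eigen_onb_def)
    note * = water_filling_equality[OF f c finite_atLeastAtMost, of "\<lambda>i j. (cmod (h i \<bullet>c e j))\<^sup>2" 1 d
      "\<lambda>i j. (cmod (u i \<bullet>c e j))\<^sup>2" mu lam M nu,
      OF _ rows[OF ho] cols[OF ho] _ rows[OF u(1)] cols[OF u(1)] mu0 lam_pos upper u_lower nu tr le]
    show "\<And>i. i \<in> {1..d} \<Longrightarrow> c < lam i \<Longrightarrow> ?q (h i) = lam i"
      by (rule *(1)) auto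
    show "\<And>i j. i \<in> {1..d} \<Longrightarrow> j \<in> {1..d} \<Longrightarrow> lam i \<le> c \<Longrightarrow> h i \<bullet>c e j \<noteq> 0 \<Longrightarrow> mu j \<le> c"
      by (rule *(2)) auto
    show "\<And>i j. i \<in> {1..d} \<Longrightarrow> j \<in> {1..d} \<Longrightarrow> i \<le> M \<Longrightarrow> lam i < c \<Longrightarrow> u i \<bullet>c e j \<noteq> 0 \<Longrightarrow> mu j = lam i"
      by (rule *(3)) auto
    show "\<And>i j. i \<in> {1..d} \<Longrightarrow> j \<in> {1..d} \<Longrightarrow> \<not> (i \<le> M \<and> lam i < c) \<Longrightarrow> u i \<bullet>c e j \<noteq> 0 \<Longrightarrow> c \<le> mu j"
      by (rule *(4)) auto
  qed

  define I where "I = {i \<in> {1..d}. i \<le> M \<and> lam i < c}"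
  have Su: "S *\<^sub>v u i = complex_of_real (lam i) \<cdot>\<^sub>v u i" if i: "i \<in> I" for i
    using i eq_case(3)[OF g] unit(1)[OF u(1)] by (intro eigenvectorI[OF e Sc]) (auto simp: I_def)
  have Au: "A *\<^sub>v u i = complex_of_real (lam i) \<cdot>\<^sub>v u i" if i: "i \<in> I" for i
    using Su[OF i] Skers[of "u i"] u(2)[of i] i unit(1)[OF u(1), of i] by (auto simp: I_def)
  have I: "I \<subseteq> {1..d}" by (auto simp: I_def)
  have uc: "u i \<in> carrier_vec d" if "i \<in> I" for i using onbD(1)[OF u(1)] I that by blast
  have uo: "u i \<bullet>c u j = (if i = j then 1 else 0)" if "i \<in> I" "j \<in> I" for i j
    using onbD(2)[OF u(1)] I that by blast
  obtain h where h: "eigen_onb d A lam h" "\<And>i. i \<in> I \<Longrightarrow> h i = u i"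
    using eigen_onb_extend[OF A g I uc uo Au] by blast
  have ho: "onb d h" using h by (simp add: eigen_onb_iff)
  have "S *\<^sub>v h i = complex_of_real (nu i) \<cdot>\<^sub>v h i" if i: "i \<in> {1..d}" for i
  proof -
    have Ah: "A *\<^sub>v h i = complex_of_real (lam i) \<cdot>\<^sub>v h i" using h i by (simp add: eigen_onb_def)
    consider "i \<in> I" | "c < lam i" | "i \<notin> I" "lam i \<le> c" by linarith
    then show ?thesis
    proof cases
      case 1
      then show ?thesis using Su[OF 1] h(2)[OF 1] nu[OF i] by (simp add: I_def)
    next
      case 2
      \<comment> \<open>Above the level there is no room for a perturbation: equality of the
        quadratic forms means that \<open>Z\<close> kills \<open>h i\<close>.\<close>
      then have "nZ (h i) = 0" using eq_case(1)[OF h(1) i 2] q_eigen[OF unit[OF ho i] Ah] by simp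
      then show ?thesis
        using Skers[OF unit(1)[OF ho i] nZ(3)[OF unit(1)[OF ho i]]] Ah nu[OF i] 2 by simp
    next
      case 3
      have "S *\<^sub>v h i = complex_of_real c \<cdot>\<^sub>v h i"
      proof (rule eigenvectorI[OF e Sc unit(1)[OF ho i]])
        fix j assume j: "j \<in> {1..d}" and ne: "h i \<bullet>c e j \<noteq> 0"
        \<comment> \<open>Since \<open>h\<close> contains the \<open>u k\<close> with
          \<open>k\<close> in \<open>I\<close>, \<open>h i\<close> is a combination of the other
          \<open>u k\<close>, which only meet eigenvalues of \<open>S\<close> that are at least
          \<open>c\<close>. The estimate for \<open>P\<close> gives at most
          \<open>c\<close>.\<close>
        have "(\<Sum>k=1..d. (h i \<bullet>c u k) * (u k \<bullet>c e j)) \<noteq> 0"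
          using ne onb_parseval[OF u(1) unit(1)[OF ho i] unit(1)[OF eo j]] by simp
        from sum.not_neutral_contains_not_neutral[OF this]
        obtain k where k: "k \<in> {1..d}" "h i \<bullet>c u k \<noteq> 0" "u k \<bullet>c e j \<noteq> 0" by auto
        have "k \<notin> I"
        proof
          assume "k \<in> I"
          then show False using k(1,2) h(2)[of k] onbD(2)[OF ho i k(1)] 3(1) by (auto split: if_splits)
        qed
        then have "c \<le> mu j" using eq_case(4)[OF g k(1) j] k by (auto simp: I_def)
        moreover have "mu j \<le> c" using eq_case(2)[OF h(1) i j 3(2) ne] .
        ultimately show "mu j = c" by simp
      qed
      moreover have "nu i = c" using nu[OF i] 3 i by (auto simp: I_def max_def)
      ultimately show ?thesis by simp
    qed
  qed
  then show ?thesis using that[of h] h(1) ho by (simp add: eigen_onb_iff)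
qed

subsection \<open>Frames and their duals\<close>

lemma analysis_op_carrier:
  "length G = n \<Longrightarrow> analysis_op d G \<in> carrier_mat n d"
  by (simp add: analysis_op_def mat_of_rows_def)

lemma adjoint_analysis_op:
  assumes "set F \<subseteq> carrier_vec d"
  shows "mat_adjoint (analysis_op d F) = mat_of_cols d F"
proof (rule eq_matI)
  note T = analysis_op_carrier[OF refl, of d F]
  fix i j assume "i < dim_row (mat_of_cols d F)" "j < dim_col (mat_of_cols d F)"
  then have ij: "i < d" "j < length F" by auto
  then have "F ! j \<in> carrier_vec d" using assms by auto
  then show "mat_adjoint (analysis_op d F) $$ (i, j) = mat_of_cols d F $$ (i, j)"
    using ij by (simp add: mat_adjoint_index[OF T])
      (simp add: analysis_op_def mat_of_rows_index mat_of_cols_index)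
qed (use mat_adjoint_carrier[OF analysis_op_carrier[OF refl, of d F]] in auto)

lemma analysis_op_surj:
  assumes U: "U \<in> carrier_mat n d"
  obtains G where "length G = n" "set G \<subseteq> carrier_vec d" "analysis_op d G = U"
proof
  let ?G = "map (\<lambda>i. conjugate (row U i)) [0..<n]"
  show "length ?G = n" "set ?G \<subseteq> carrier_vec d" using U by auto
  have "map conjugate ?G = rows U" using U by (auto simp: rows_def)
  then show "analysis_op d ?G = U" using U unfolding analysis_op_def by (metis carrier_matD(2) mat_of_rows_rows)
qed

text \<open>The columns of the adjoint are the frame vectors, so the span condition in
  \<open>frames\<close> becomes surjectivity of the adjoint, the form used from here on.\<close>

lemma span_eq_range_adjoint:
  assumes F: "set F \<subseteq> carrier_vec d"
  shows "LinearCombinations.module.span class_ring (module_vec TYPE(complex) d) (set F)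
    = {mat_adjoint (analysis_op d F) *\<^sub>v y | y. y \<in> carrier_vec (length F)}"
proof -
  interpret vec_space "TYPE(complex)" d .
  have lc: "lincomb_list c F = mat_adjoint (analysis_op d F) *\<^sub>v vec (length F) c" for c
    using F unfolding adjoint_analysis_op[OF F] by (intro lincomb_list_as_mat_mult) auto
  have "span_list F = {mat_adjoint (analysis_op d F) *\<^sub>v y | y. y \<in> carrier_vec (length F)}"
  proof (intro equalityI subsetI)
    fix x assume "x \<in> span_list F"
    then obtain c where "x = lincomb_list c F" by (auto simp: span_list_def)
    then show "x \<in> {mat_adjoint (analysis_op d F) *\<^sub>v y | y. y \<in> carrier_vec (length F)}"
      unfolding lc by auto
  next
    fix x assume "x \<in> {mat_adjoint (analysis_op d F) *\<^sub>v y | y. y \<in> carrier_vec (length F)}"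
    then obtain y where y: "y \<in> carrier_vec (length F)" "x = mat_adjoint (analysis_op d F) *\<^sub>v y" by auto
    have "vec (length F) (\<lambda>i. y $ i) = y" using y(1) by auto
    then have "x = lincomb_list (\<lambda>i. y $ i) F" unfolding lc y(2) by simp
    then show "x \<in> span_list F" by (auto simp: span_list_def)
  qed
  then show ?thesis using span_list_as_span[OF F] by simp
qed

lemma frame_analysis_injective:
  assumes F: "F \<in> frames n d" and x: "x \<in> carrier_vec d" and Tx: "analysis_op d F *\<^sub>v x = 0\<^sub>v n"
  shows "x = 0\<^sub>v d"
proof -
  have F': "length F = n" "set F \<subseteq> carrier_vec d" using F by (auto simp: frames_def)
  note T = analysis_op_carrier[OF F'(1), of d]
  have "x \<in> {mat_adjoint (analysis_op d F) *\<^sub>v y | y. y \<in> carrier_vec n}"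
    using F x span_eq_range_adjoint[OF F'(2)] F'(1) unfolding frames_def by blast
  then obtain y where y: "y \<in> carrier_vec n" "x = mat_adjoint (analysis_op d F) *\<^sub>v y" by auto
  have "x \<bullet>c x = y \<bullet>c (analysis_op d F *\<^sub>v x)"
    using cscalar_adjoint[OF mat_adjoint_carrier[OF T] y(1) x] y(2)
    by (simp add: mat_adjoint_adjoint[OF T])
  also have "\<dots> = 0" using y(1) by (simp add: Tx cscalar_sum[of _ n])
  finally show ?thesis using cscalar_self_eq_0[OF x] by simp
qed

text \<open>Every \<open>x\<close> is the image of \<open>T x\<close> under the adjoint, so the
  duality equation alone yields the spanning property.\<close>

lemma frame_if_left_inverse:
  assumes G: "length G = n" "set G \<subseteq> carrier_vec d" and T: "T \<in> carrier_mat n d"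
    and inv: "mat_adjoint (analysis_op d G) * T = 1\<^sub>m d"
  shows "G \<in> frames n d"
proof -
  note U = analysis_op_carrier[OF G(1), of d]
  have "{mat_adjoint (analysis_op d G) *\<^sub>v y | y. y \<in> carrier_vec n} = carrier_vec d"
  proof (intro equalityI subsetI)
    fix x :: "complex vec" assume x: "x \<in> carrier_vec d"
    have "x = mat_adjoint (analysis_op d G) *\<^sub>v (T *\<^sub>v x)"
      using assoc_mult_mat_vec[OF mat_adjoint_carrier[OF U] T x] inv x by simp
    then show "x \<in> {mat_adjoint (analysis_op d G) *\<^sub>v y | y. y \<in> carrier_vec n}" using T x by auto
  qed (use mat_adjoint_carrier[OF U] in auto)
  then show ?thesis using G by (simp add: frames_def span_eq_range_adjoint)
qed

section \<open>The inverse frame operator and the decomposition of duals\<close>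

lemma mat_adjoint_minus:
  fixes A B :: "complex mat"
  assumes "A \<in> carrier_mat n d" "B \<in> carrier_mat n d"
  shows "mat_adjoint (A - B) = mat_adjoint A - mat_adjoint B"
  using assms mat_adjoint_carrier[of A n d] mat_adjoint_carrier[of B n d]
    mat_adjoint_carrier[OF minus_carrier_mat[OF assms(2)], of A]
  by (intro eq_matI)
    (auto simp: mat_adjoint_index[of _ n d] mat_adjoint_index[OF minus_carrier_mat[OF assms(2)]])

lemma mat_adjoint_add:
  fixes A B :: "complex mat"
  assumes "A \<in> carrier_mat n d" "B \<in> carrier_mat n d"
  shows "mat_adjoint (A + B) = mat_adjoint A + mat_adjoint B"
  using assms mat_adjoint_carrier[of A n d] mat_adjoint_carrier[of B n d]
    mat_adjoint_carrier[OF add_carrier_mat[OF assms(2)], of A]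
  by (intro eq_matI)
    (auto simp: mat_adjoint_index[of _ n d] mat_adjoint_index[OF add_carrier_mat[OF assms(2)]])

lemma mat_adjoint_gram:
  fixes U :: "complex mat"
  assumes "U \<in> carrier_mat n d"
  shows "mat_adjoint (mat_adjoint U * U) = mat_adjoint U * U"
  using mat_adjoint_mult[OF mat_adjoint_carrier[OF assms] assms] by (simp add: mat_adjoint_adjoint[OF assms])

text \<open>The kernel of the frame operator is that of \<open>T\<close>, hence trivial; so
  \<open>mat_inverse\<close> returns a value and the \<open>the\<close> in
  \<open>frame_op_inv\<close> is meaningful.\<close>

lemma frame_op_inv_props:
  assumes F: "F \<in> frames n d"
  defines "T \<equiv> analysis_op d F" and "A \<equiv> frame_op_inv d F"
  shows "A \<in> carrier_mat d d" "mat_adjoint T * T * A = 1\<^sub>m d" "A * (mat_adjoint T * T) = 1\<^sub>m d"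
    "mat_adjoint A = A"
proof -
  have "length F = n" using F by (simp add: frames_def)
  then have T: "T \<in> carrier_mat n d" unfolding T_def by (rule analysis_op_carrier)
  note T' = mat_adjoint_carrier[OF T]
  define S where "S = mat_adjoint T * T"
  have S: "S \<in> carrier_mat d d" using T T' by (simp add: S_def)
  have "det S \<noteq> 0"
  proof
    assume "det S = 0"
    then obtain x where x: "x \<in> carrier_vec d" "x \<noteq> 0\<^sub>v d" "S *\<^sub>v x = 0\<^sub>v d"
      using det_0_iff_vec_prod_zero[OF S] by auto
    have Tx: "T *\<^sub>v x \<in> carrier_vec n" using T x by simp
    have "(T *\<^sub>v x) \<bullet>c (T *\<^sub>v x) = x \<bullet>c (S *\<^sub>v x)"
      using cscalar_adjoint[OF T x(1) Tx] assoc_mult_mat_vec[OF T' T x(1)] by (simp add: S_def)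
    also have "\<dots> = 0" using x by (simp add: cscalar_sum[of _ d])
    finally have "T *\<^sub>v x = 0\<^sub>v n" using cscalar_self_eq_0[OF Tx] by simp
    then show False using frame_analysis_injective[OF F x(1)] x(2) by (simp add: T_def)
  qed
  then have "S \<in> Units (ring_mat TYPE(complex) d ())" by (rule det_non_zero_imp_unit[OF S])
  then obtain B where "mat_inverse S = Some B" using mat_inverse(1)[OF S, of "()"] by (cases "mat_inverse S") auto
  then have B: "S * A = 1\<^sub>m d" "A * S = 1\<^sub>m d" "A \<in> carrier_mat d d"
    using mat_inverse(2)[OF S] by (auto simp: A_def frame_op_inv_def frame_op_def S_def T_def)
  then show A: "A \<in> carrier_mat d d" and "mat_adjoint T * T * A = 1\<^sub>m d" "A * (mat_adjoint T * T) = 1\<^sub>m d"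
    by (auto simp: S_def)
  have "mat_adjoint A * S = 1\<^sub>m d"
    using mat_adjoint_mult[OF S A] B(1) mat_adjoint_gram[OF T] by (simp add: mat_adjoint_one S_def[symmetric])
  then have "mat_adjoint A * S * A = A" using A by simp
  moreover have "mat_adjoint A * S * A = mat_adjoint A * (S * A)"
    by (rule assoc_mult_mat[OF mat_adjoint_carrier[OF A] S A])
  ultimately show "mat_adjoint A = A" using B(1) mat_adjoint_carrier[OF A] by simp
qed

text \<open>Applying the frame operator to the eigenvalue equation gives that the squared norm of
  \<open>x\<close> is \<open>l\<close> times that of \<open>T x\<close>.\<close>

lemma frame_op_inv_eigenvalue_pos:
  assumes F: "F \<in> frames n d" and x: "x \<in> carrier_vec d" "x \<noteq> 0\<^sub>v d"
    and ev: "frame_op_inv d F *\<^sub>v x = complex_of_real l \<cdot>\<^sub>v x"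
  shows "0 < l"
proof -
  let ?T = "analysis_op d F"
  have "length F = n" using F by (simp add: frames_def)
  then have T: "?T \<in> carrier_mat n d" by (rule analysis_op_carrier)
  note T' = mat_adjoint_carrier[OF T] and A = frame_op_inv_props[OF F]
  have Tx: "?T *\<^sub>v x \<in> carrier_vec n" using T x by simp
  have "x = (mat_adjoint ?T * ?T * frame_op_inv d F) *\<^sub>v x" using A(2) x by simp
  also have "\<dots> = (mat_adjoint ?T * ?T) *\<^sub>v (complex_of_real l \<cdot>\<^sub>v x)"
    using assoc_mult_mat_vec[OF mult_carrier_mat[OF T' T] A(1) x(1)] ev by simp
  also have "\<dots> = complex_of_real l \<cdot>\<^sub>v (mat_adjoint ?T *\<^sub>v (?T *\<^sub>v x))"
    using T T' x by (simp add: mult_mat_vec[of _ d d] assoc_mult_mat_vec[OF T' T x(1)])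
  finally have eq: "x = complex_of_real l \<cdot>\<^sub>v (mat_adjoint ?T *\<^sub>v (?T *\<^sub>v x))" .
  have "x \<bullet>c x = (complex_of_real l \<cdot>\<^sub>v (mat_adjoint ?T *\<^sub>v (?T *\<^sub>v x))) \<bullet>c x" by (subst (1) eq) simp
  also have "\<dots> = complex_of_real l * ((?T *\<^sub>v x) \<bullet>c (?T *\<^sub>v x))"
    using x T' Tx cscalar_adjoint[OF T' Tx x(1)]
    by (simp add: cscalar_smult[of _ d] mat_adjoint_adjoint[OF T])
  finally have "(\<Sum>a<d. (cmod (x $ a))\<^sup>2) = l * (\<Sum>a<n. (cmod ((?T *\<^sub>v x) $ a))\<^sup>2)"
    unfolding cscalar_self[OF x(1)] cscalar_self[OF Tx] by (simp only: of_real_mult[symmetric] of_real_eq_iff)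
  moreover have "0 < (\<Sum>a<d. (cmod (x $ a))\<^sup>2)"
  proof -
    have "(\<Sum>a<d. (cmod (x $ a))\<^sup>2) \<noteq> 0" using cscalar_self[OF x(1)] cscalar_self_eq_0[OF x(1)] x(2) by force
    moreover have "0 \<le> (\<Sum>a<d. (cmod (x $ a))\<^sup>2)" by (intro sum_nonneg) auto
    ultimately show ?thesis by linarith
  qed
  moreover have "0 \<le> (\<Sum>a<n. (cmod ((?T *\<^sub>v x) $ a))\<^sup>2)" by (intro sum_nonneg) auto
  ultimately show ?thesis by (metis zero_less_mult_pos2 zero_less_mult_iff not_less)
qed

text \<open>Every dual is the canonical dual plus a part with range orthogonal to that of the analysis
  operator, and the cross terms cancel in the frame operator.\<close>

lemma dual_gram:
  assumes F: "F \<in> frames n d" and U: "U \<in> carrier_mat n d"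
  defines "T \<equiv> analysis_op d F" and "A \<equiv> frame_op_inv d F"
  assumes dual: "mat_adjoint U * T = 1\<^sub>m d"
  shows "mat_adjoint U * U = A + mat_adjoint (U - T * A) * (U - T * A)"
proof -
  have "length F = n" using F by (simp add: frames_def)
  then have T: "T \<in> carrier_mat n d" unfolding T_def by (rule analysis_op_carrier)
  note T' = mat_adjoint_carrier[OF T] and U' = mat_adjoint_carrier[OF U]
  note A = frame_op_inv_props[OF F, folded T_def A_def]
  define W where "W = T * A"
  have W: "W \<in> carrier_mat n d" using T A by (simp add: W_def)
  note W' = mat_adjoint_carrier[OF W]
  have UW: "mat_adjoint U * W = A"
    using assoc_mult_mat[OF U' T A(1)] dual A(1) by (simp add: W_def)
  have WU: "mat_adjoint W * U = A"
    using mat_adjoint_mult[OF U' W] UW A(4) by (simp add: mat_adjoint_adjoint[OF U])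
  have WW: "mat_adjoint W * W = A"
  proof -
    have "mat_adjoint W = A * mat_adjoint T" using mat_adjoint_mult[OF T A(1)] A(4) by (simp add: W_def)
    then have "mat_adjoint W * W = A * (mat_adjoint T * T * A)"
      using A(1) T T' by (simp add: W_def assoc_mult_mat[of _ d d _ n _ d] assoc_mult_mat[of _ d n _ d _ d])
    then show ?thesis using A(1,2) by simp
  qed
  have "mat_adjoint (U - W) * (U - W) = (mat_adjoint U - mat_adjoint W) * (U - W)"
    by (simp add: mat_adjoint_minus[OF U W])
  also have "\<dots> = (mat_adjoint U * U - mat_adjoint U * W) - (mat_adjoint W * U - mat_adjoint W * W)"
    using U W U' W'
    by (simp add: minus_mult_distrib_mat[OF U' W' minus_carrier_mat[OF W]]
        mult_minus_distrib_mat[OF U' U W] mult_minus_distrib_mat[OF W' U W])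
  also have "\<dots> = (mat_adjoint U * U - A) - (A - A)" by (simp only: UW WU WW)
  finally have eq: "mat_adjoint (U - W) * (U - W) = (mat_adjoint U * U - A) - (A - A)" .
  show ?thesis
    unfolding W_def[symmetric] eq using A(1) U U' by (intro eq_matI) auto
qed

text \<open>The pairs \<open>(u, y)\<close> with \<open>U u = T y\<close> form the kernel of \<open>n\<close> equations in \<open>2 d\<close> unknowns, and
  \<open>u\<close> determines \<open>y = A u\<close>.\<close>

lemma dual_kernel:
  assumes F: "F \<in> frames n d" and U: "U \<in> carrier_mat n d"
  defines "T \<equiv> analysis_op d F" and "A \<equiv> frame_op_inv d F"
  assumes dual: "mat_adjoint U * T = 1\<^sub>m d"
    and ws: "set ws \<subseteq> carrier_vec d" and len: "n + length ws < 2 * d"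
  shows "\<exists>u\<in>carrier_vec d. u \<bullet>c u = 1 \<and> (U - T * A) *\<^sub>v u = 0\<^sub>v n \<and> (\<forall>w\<in>set ws. u \<bullet>c w = 0)"
proof -
  have "length F = n" using F by (simp add: frames_def)
  then have T: "T \<in> carrier_mat n d" unfolding T_def by (rule analysis_op_carrier)
  note T' = mat_adjoint_carrier[OF T] and U' = mat_adjoint_carrier[OF U]
  note A = frame_op_inv_props[OF F, folded T_def A_def]
  \<comment> \<open>The first \<open>n\<close> rows say \<open>U u = T y\<close>, the others that
    \<open>u\<close> is orthogonal to \<open>ws\<close>; positions from \<open>d\<close> on hold the
    coordinates of \<open>y\<close>.\<close>
  define eqn where "eqn i = vec (2 * d) (\<lambda>a. if i < n then (if a < d then U $$ (i, a) else - T $$ (i, a - d))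
      else (if a < d then cnj (ws ! (i - n) $ a) else 0))" for i
  obtain z where z: "z \<in> carrier_vec (2 * d)" "z \<noteq> 0\<^sub>v (2 * d)"
    and sol: "\<And>i. i < n + length ws \<Longrightarrow> (\<Sum>a<2*d. eqn i $ a * z $ a) = 0"
    using homogeneous_system_solution[OF len, of eqn] by blast
  define u where "u = vec d (\<lambda>a. z $ a)"
  define y where "y = vec d (\<lambda>a. z $ (a + d))"
  have u: "u \<in> carrier_vec d" and y: "y \<in> carrier_vec d" by (auto simp: u_def y_def)
  have split_sum: "(\<Sum>a<2*d. g a) = (\<Sum>a<d. g a) + (\<Sum>a<d. g (a + d))" for g :: "nat \<Rightarrow> complex"
    using sum.atLeastLessThan_concat[of 0 d "2 * d" g] sum.shift_bounds_nat_ivl[of g 0 d d]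
    by (simp add: atLeast0LessThan mult_2)
  have UT: "U *\<^sub>v u = T *\<^sub>v y"
  proof (rule eq_vecI)
    fix i assume "i < dim_vec (T *\<^sub>v y)"
    then have i: "i < n" using T by simp
    have "(\<Sum>a<d. U $$ (i, a) * u $ a) - (\<Sum>a<d. T $$ (i, a) * y $ a) = 0"
      using sol[of i] i unfolding split_sum by (simp add: eqn_def u_def y_def sum_negf)
    then show "(U *\<^sub>v u) $ i = (T *\<^sub>v y) $ i"
      using i U T u y by (simp add: scalar_prod_def atLeast0LessThan)
  qed (use U T in auto)
  have orth: "u \<bullet>c w = 0" if w: "w \<in> set ws" for w
  proof -
    obtain i where i: "i < length ws" "w = ws ! i" using w by (metis in_set_conv_nth)
    have "w \<in> carrier_vec d" using ws w by auto
    then show ?thesis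
      using sol[of "n + i"] i unfolding split_sum
      by (simp add: eqn_def u_def cscalar_sum[of _ d] mult.commute)
  qed
  \<comment> \<open>Applying the adjoint of \<open>T\<close> to \<open>U u = T y\<close> recovers
    \<open>u\<close> as the frame operator applied to \<open>y\<close>. Hence
    \<open>y = A u\<close>, and a nonzero solution has nonzero \<open>u\<close>.\<close>
  have "mat_adjoint T * U = 1\<^sub>m d"
    using mat_adjoint_mult[OF U' T] dual by (simp add: mat_adjoint_adjoint[OF U] mat_adjoint_one)
  then have "u = mat_adjoint T *\<^sub>v (U *\<^sub>v u)" using assoc_mult_mat_vec[OF T' U u] u by simp
  also have "\<dots> = (mat_adjoint T * T) *\<^sub>v y" unfolding UT using assoc_mult_mat_vec[OF T' T y] by simp
  finally have "A *\<^sub>v u = A *\<^sub>v ((mat_adjoint T * T) *\<^sub>v y)" by simp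
  also have "\<dots> = (A * (mat_adjoint T * T)) *\<^sub>v y"
    using assoc_mult_mat_vec[OF A(1) mult_carrier_mat[OF T' T] y] by simp
  finally have yA: "y = A *\<^sub>v u" using A(3) y by simp
  have TA: "T * A \<in> carrier_mat n d" using T A(1) by simp
  have ker: "(U - T * A) *\<^sub>v u = 0\<^sub>v n"
  proof -
    have "(U - T * A) *\<^sub>v u = U *\<^sub>v u - (T * A) *\<^sub>v u"
      by (rule minus_mult_distrib_mat_vec[OF U TA u])
    also have "\<dots> = U *\<^sub>v u - T *\<^sub>v y" using assoc_mult_mat_vec[OF T A(1) u] yA by simp
    also have "\<dots> = 0\<^sub>v n" unfolding UT using T y by simp
    finally show ?thesis .
  qed
  have "u \<noteq> 0\<^sub>v d"
  proof
    assume u0: "u = 0\<^sub>v d"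
    then have "y = 0\<^sub>v d" using yA A(1) by auto
    have "z $ a = 0" if "a < 2 * d" for a
    proof (cases "a < d")
      case True
      then show ?thesis using arg_cong[OF u0, of "\<lambda>v. v $ a"] by (simp add: u_def)
    next
      case False
      then show ?thesis using arg_cong[OF \<open>y = 0\<^sub>v d\<close>, of "\<lambda>v. v $ (a - d)"] that False by (simp add: y_def)
    qed
    then have "z = 0\<^sub>v (2 * d)" using z(1) by (intro eq_vecI) auto
    then show False using z(2) by simp
  qed
  then obtain a where a: "(a \<cdot>\<^sub>v u) \<bullet>c (a \<cdot>\<^sub>v u) = 1" using normalize_vec[OF u] by blast
  have "(U - T * A) *\<^sub>v (a \<cdot>\<^sub>v u) = 0\<^sub>v n"
    using mult_mat_vec[OF minus_carrier_mat[OF TA] u] ker by auto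
  moreover have "\<forall>w\<in>set ws. (a \<cdot>\<^sub>v u) \<bullet>c w = 0"
    using orth u ws by (auto simp: cscalar_smult[of _ d] subset_iff)
  ultimately show ?thesis using a u by (intro bexI[of _ "a \<cdot>\<^sub>v u"]) auto
qed

text \<open>The next vector must avoid the \<open>d\<close> columns of \<open>T\<close> and the
  vectors already found, fewer than \<open>n\<close> conditions as long as there is room.\<close>

lemma orthonormal_cokernel:
  fixes T :: "complex mat"
  assumes T: "T \<in> carrier_mat n d" and k: "d + k \<le> n"
  obtains q where "\<And>i. i < k \<Longrightarrow> q i \<in> carrier_vec n" "\<And>i. i < k \<Longrightarrow> mat_adjoint T *\<^sub>v q i = 0\<^sub>v d"
    "\<And>i j. i < k \<Longrightarrow> j < k \<Longrightarrow> q i \<bullet>c q j = (if i = j then 1 else 0)"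
proof -
  have "\<exists>q. (\<forall>i<k. q i \<in> carrier_vec n \<and> mat_adjoint T *\<^sub>v q i = 0\<^sub>v d) \<and>
      (\<forall>i<k. \<forall>j<k. q i \<bullet>c q j = (if i = j then 1 else 0))"
    using k
  proof (induction k)
    case (Suc k)
    then obtain q where q: "\<And>i. i < k \<Longrightarrow> q i \<in> carrier_vec n" "\<And>i. i < k \<Longrightarrow> mat_adjoint T *\<^sub>v q i = 0\<^sub>v d"
      "\<And>i j. i < k \<Longrightarrow> j < k \<Longrightarrow> q i \<bullet>c q j = (if i = j then 1 else 0)" by auto
    define ws where "ws = map (col T) [0..<d] @ map q [0..<k]"
    have "set ws \<subseteq> carrier_vec n" "length ws < n" using q(1) T Suc.prems by (auto simp: ws_def)
    then obtain x where x: "x \<in> carrier_vec n" "x \<bullet>c x = 1" "\<And>w. w \<in> set ws \<Longrightarrow> x \<bullet>c w = 0"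
      using orthogonal_unit_vec by blast
    have Tx: "mat_adjoint T *\<^sub>v x = 0\<^sub>v d"
    proof (rule eq_vecI)
      fix a assume "a < dim_vec (0\<^sub>v d :: complex vec)"
      then have a: "a < d" by simp
      have "(mat_adjoint T *\<^sub>v x) $ a = (\<Sum>i<n. cnj (T $$ (i, a)) * x $ i)"
        using a x(1) mat_adjoint_carrier[OF T]
        by (auto simp: scalar_prod_def atLeast0LessThan mat_adjoint_index[OF T a] intro!: sum.cong)
      also have "\<dots> = x \<bullet>c col T a"
        using T a by (simp add: cscalar_sum[of _ n] mult.commute)
      also have "\<dots> = 0" using a by (intro x(3)) (simp add: ws_def)
      finally show "(mat_adjoint T *\<^sub>v x) $ a = 0\<^sub>v d $ a" using a by simp
    qed (use mat_adjoint_carrier[OF T] in auto)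
    have xq: "x \<bullet>c q i = 0" if "i < k" for i using that by (intro x(3)) (simp add: ws_def)
    have qx: "q i \<bullet>c x = 0" if i: "i < k" for i
      using xq[OF i] cscalar_cnj[OF x(1) q(1)[OF i]] by simp
    show ?case
      using q x(1,2) Tx xq qx by (intro exI[of _ "q(k := x)"]) (auto simp: less_Suc_eq)
  qed simp
  then show ?thesis using that by blast
qed

text \<open>\<open>Z\<close> maps \<open>h i\<close> to \<open>sqrt (b i)\<close> times its own
  cokernel vector for \<open>i > R\<close>, and to 0 otherwise. The bound
  \<open>2 * d <= n + R\<close> says that the \<open>d - R\<close> vectors needed fit into the
  \<open>n - d\<close> available dimensions.\<close>

lemma cokernel_factor:
  fixes T :: "complex mat" and b :: "nat \<Rightarrow> real"
  assumes T: "T \<in> carrier_mat n d" and h: "onb d h" and R: "R \<le> d" "2 * d \<le> n + R"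
    and b: "\<And>i. i \<in> {1..d} \<Longrightarrow> 0 \<le> b i" "\<And>i. i \<in> {1..R} \<Longrightarrow> b i = 0"
  obtains Z where "Z \<in> carrier_mat n d" "mat_adjoint T * Z = 0\<^sub>m d d"
    "\<And>i. i \<in> {1..d} \<Longrightarrow> (mat_adjoint Z * Z) *\<^sub>v h i = complex_of_real (b i) \<cdot>\<^sub>v h i"
proof -
  have "d + (d - R) \<le> n" using R by simp
  then obtain q where q: "\<And>i. i < d - R \<Longrightarrow> q i \<in> carrier_vec n"
    "\<And>i. i < d - R \<Longrightarrow> mat_adjoint T *\<^sub>v q i = 0\<^sub>v d"
    "\<And>i j. i < d - R \<Longrightarrow> j < d - R \<Longrightarrow> q i \<bullet>c q j = (if i = j then 1 else 0)"
    using orthonormal_cokernel[OF T] by metis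
  \<comment> \<open>The shift sends the indices \<open>R + 1, ..., d\<close> to
    \<open>0, ..., d - R - 1\<close>, where \<open>q\<close> is given.\<close>
  define Q where "Q i = (if i \<in> {R<..d} then complex_of_real (sqrt (b i)) \<cdot>\<^sub>v q (i - R - 1) else 0\<^sub>v n)" for i
  have Qc: "Q i \<in> carrier_vec n" for i using q(1) by (auto simp: Q_def)
  have TQ: "mat_adjoint T *\<^sub>v Q i = 0\<^sub>v d" for i
  proof (cases "i \<in> {R<..d}")
    case True
    then have "i - R - 1 < d - R" by auto
    then show ?thesis
      using True q mult_mat_vec[OF mat_adjoint_carrier[OF T] q(1)] by (auto simp: Q_def)
  next
    case False
    then show ?thesis using mat_adjoint_carrier[OF T] unfolding Q_def by (auto intro!: eq_vecI)
  qed
  have QQ: "Q i \<bullet>c Q j = (if i = j then complex_of_real (b i) else 0)" if ij: "i \<in> {1..d}" "j \<in> {1..d}" for i j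
  proof (cases "i \<in> {R<..d} \<and> j \<in> {R<..d}")
    case True
    then have k: "i - R - 1 < d - R" "j - R - 1 < d - R" "i - R - 1 = j - R - 1 \<longleftrightarrow> i = j" by auto
    have "complex_of_real (sqrt (b i)) * complex_of_real (sqrt (b i)) = complex_of_real (b i)"
      using b(1)[OF ij(1)] by (simp only: of_real_mult[symmetric] real_sqrt_mult_self abs_of_nonneg)
    then show ?thesis
      using True k q(1)[OF k(1)] q(1)[OF k(2)] q(3)[OF k(1,2)]
      by (cases "i = j") (auto simp: Q_def cscalar_smult[of _ n] simp del: of_real_mult)
  next
    case False
    then have "Q i = 0\<^sub>v n \<or> Q j = 0\<^sub>v n" "i = j \<Longrightarrow> b i = 0" using b(2)[of i] ij by (auto simp: Q_def)
    then show ?thesis using Qc[of i] Qc[of j] by (auto simp: cscalar_sum[of _ n])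
  qed
  define Z where "Z = mat n d (\<lambda>(p, a). \<Sum>i=1..d. Q i $ p * cnj (h i $ a))"
  have Z: "Z \<in> carrier_mat n d" by (simp add: Z_def)
  note Z' = mat_adjoint_carrier[OF Z]
  have Zh: "Z *\<^sub>v h j = Q j" if j: "j \<in> {1..d}" for j
  proof (rule eq_vecI)
    fix p assume "p < dim_vec (Q j)"
    then have p: "p < n" using Qc[of j] by simp
    have "(Z *\<^sub>v h j) $ p = (\<Sum>a<d. \<Sum>i=1..d. Q i $ p * (h j $ a * cnj (h i $ a)))"
      using p onb_dim[OF h j]
      by (simp add: Z_def scalar_prod_def atLeast0LessThan sum_distrib_left mult_ac)
    also have "\<dots> = (\<Sum>i=1..d. Q i $ p * (h j \<bullet>c h i))"
      by (subst sum.swap) (simp add: sum_distrib_left cscalar_sum[OF onbD(1)[OF h]])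
    also have "\<dots> = (\<Sum>i=1..d. if i = j then Q i $ p else 0)"
      using onbD(2)[OF h j] by (intro sum.cong) auto
    finally show "(Z *\<^sub>v h j) $ p = Q j $ p" using j by simp
  qed (use Z Qc[of j] in auto)
  show ?thesis
  proof (rule that[of Z])
    show "mat_adjoint T * Z = 0\<^sub>m d d"
    proof (rule onb_mat_eqI[OF h])
      fix i assume i: "i \<in> {1..d}"
      then show "(mat_adjoint T * Z) *\<^sub>v h i = 0\<^sub>m d d *\<^sub>v h i"
        using assoc_mult_mat_vec[OF mat_adjoint_carrier[OF T] Z onbD(1)[OF h i]] Zh[OF i] TQ[of i] onbD(1)[OF h i]
        by (auto intro!: eq_vecI)
    qed (use mat_adjoint_carrier[OF T] Z in auto)
    fix i assume i: "i \<in> {1..d}"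
    note hi = onbD(1)[OF h i]
    show "(mat_adjoint Z * Z) *\<^sub>v h i = complex_of_real (b i) \<cdot>\<^sub>v h i"
    proof (rule onb_vec_eqI[OF h])
      fix j assume j: "j \<in> {1..d}"
      note hj = onbD(1)[OF h j]
      have "((mat_adjoint Z * Z) *\<^sub>v h i) \<bullet>c h j = (mat_adjoint Z *\<^sub>v Q i) \<bullet>c h j"
        using assoc_mult_mat_vec[OF Z' Z hi] Zh[OF i] by simp
      also have "\<dots> = Q i \<bullet>c Q j"
        using cscalar_adjoint[OF Z' Qc hj] Zh[OF j] by (simp add: mat_adjoint_adjoint[OF Z])
      also have "\<dots> = (complex_of_real (b i) \<cdot>\<^sub>v h i) \<bullet>c h j"
        using QQ[OF i j] onbD(2)[OF h i j] hi hj by (simp add: cscalar_smult[of _ d])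
      finally show "((mat_adjoint Z * Z) *\<^sub>v h i) \<bullet>c h j = (complex_of_real (b i) \<cdot>\<^sub>v h i) \<bullet>c h j" .
    qed (use Z Z' hi in auto)
  qed (rule Z)
qed

subsection \<open>Minimizers of convex potentials\<close>

lemma mat_sum_shift:
  fixes k l :: nat
  shows "mat_sum d (\<lambda>i. X (k + i)) {1..l - k} = mat_sum d X {k<..l}"
proof -
  have "(\<Sum>i=1..l-k. X (k + i) $$ (a, b)) = (\<Sum>i\<in>{k<..l}. X i $$ (a, b))" for a b
    by (rule sum.reindex_bij_witness[of _ "\<lambda>i. i - k" "\<lambda>i. k + i"]) auto
  then show ?thesis by (simp add: mat_sum_def)
qed

lemma eigen_onb_difference:
  assumes A: "A \<in> carrier_mat d d" "eigen_onb d A lam h" and S: "S \<in> carrier_mat d d" "eigen_onb d S nu h"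
    and nu: "\<And>i. i \<in> {1..R} \<Longrightarrow> nu i = lam i" "\<And>i. i \<in> {R<..d} \<Longrightarrow> nu i = c"
  shows "S = A + mat_sum d (\<lambda>i. complex_of_real (c - lam (R + i)) \<cdot>\<^sub>m outer (h (R + i)) (h (R + i))) {1..d - R}"
proof -
  have h: "onb d h" using A by (simp add: eigen_onb_iff)
  let ?B = "spectral_sum d (\<lambda>i. c - lam i) h {R<..d}"
  have "S = A + ?B"
  proof (rule onb_mat_eqI[OF h S(1)])
    fix i assume i: "i \<in> {1..d}"
    have "{R<..d} \<subseteq> {1..d}" by auto
    note B = spectral_sum_onb[OF h this i, of "\<lambda>i. c - lam i"]
    have "nu i = lam i + (if i \<in> {R<..d} then c - lam i else 0)" using nu[of i] i by auto
    then have "complex_of_real (nu i) \<cdot>\<^sub>v h i = complex_of_real (lam i) \<cdot>\<^sub>v h i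
        + complex_of_real (if i \<in> {R<..d} then c - lam i else 0) \<cdot>\<^sub>v h i"
      using onbD(1)[OF h i] by (simp only: of_real_add add_smult_distrib_vec)
    then show "S *\<^sub>v h i = (A + ?B) *\<^sub>v h i"
      using A(2) S(2) i B unfolding eigen_onb_iff
      by (subst add_mult_distrib_mat_vec[OF A(1) spectral_sum_carrier onbD(1)[OF h i]]) metis
  qed (rule add_carrier_mat[OF spectral_sum_carrier])
  then show ?thesis
    using mat_sum_shift[of d "\<lambda>i. complex_of_real (c - lam i) \<cdot>\<^sub>m outer (h i) (h i)" R d] by (simp only:)
qed

text \<open>The last two facts reduce trace and potential to sums of eigenvalues over any
  eigenbasis.\<close>

lemma duals_gram:
  assumes "G \<in> duals n d t F"
  shows "frame_op d G \<in> carrier_mat d d" "mat_adjoint (frame_op d G) = frame_op d G"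
    "eigen_onb d (frame_op d G) a h \<Longrightarrow> t \<le> (\<Sum>i=1..d. a i)"
    "eigen_onb d (frame_op d G) a h \<Longrightarrow> frame_potential d f G = (\<Sum>i=1..d. f (a i))"
proof -
  have "length G = n" using assms by (simp add: duals_def frames_def)
  then have U: "analysis_op d G \<in> carrier_mat n d" by (rule analysis_op_carrier)
  show S: "frame_op d G \<in> carrier_mat d d"
    unfolding frame_op_def using U mat_adjoint_carrier[OF U] by simp
  show her: "mat_adjoint (frame_op d G) = frame_op d G"
    unfolding frame_op_def by (rule mat_adjoint_gram[OF U])
  obtain e where e: "eigen_onb d (frame_op d G) (eigval (frame_op d G)) e"
    using hermitian_eigen_onb[OF S her] by blast
  assume h: "eigen_onb d (frame_op d G) a h"
  show "t \<le> (\<Sum>i=1..d. a i)"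
    using assms trace_eigen[OF h S] unfolding duals_def by (metis (mono_tags, lifting) Re_complex_of_real mem_Collect_eq)
  show "frame_potential d f G = (\<Sum>i=1..d. f (a i))"
    unfolding frame_potential_def trace_fun_calc[OF e h S] by (rule Re_complex_of_real)
qed

text \<open>Adding to the canonical dual \<open>T * A\<close> a \<open>Z\<close> with range
  orthogonal to that of \<open>T\<close> preserves duality, and \<open>Z\<close> can be chosen to
  raise each \<open>lam i\<close> beyond \<open>R\<close> to \<open>nu i\<close>. This shows that
  the lower bound is attained.\<close>

lemma dual_with_spectrum:
  assumes F: "F \<in> frames n d" and h: "eigen_onb d (frame_op_inv d F) lam h"
    and R: "R \<le> d" "2 * d \<le> n + R"
    and nu: "\<And>i. i \<in> {1..d} \<Longrightarrow> lam i \<le> nu i" "\<And>i. i \<in> {1..R} \<Longrightarrow> nu i = lam i"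
    and t: "t \<le> (\<Sum>i=1..d. nu i)"
  obtains G where "G \<in> duals n d t F" "eigen_onb d (frame_op d G) nu h"
proof -
  define T where "T = analysis_op d F"
  define A where "A = frame_op_inv d F"
  have "length F = n" using F by (simp add: frames_def)
  then have T: "T \<in> carrier_mat n d" unfolding T_def by (rule analysis_op_carrier)
  note A = frame_op_inv_props[OF F, folded T_def A_def] and T' = mat_adjoint_carrier[OF T]
  have ho: "onb d h" using h by (simp add: eigen_onb_iff)
  obtain Z where Z: "Z \<in> carrier_mat n d" "mat_adjoint T * Z = 0\<^sub>m d d"
    and Zh: "\<And>i. i \<in> {1..d} \<Longrightarrow> (mat_adjoint Z * Z) *\<^sub>v h i = complex_of_real (nu i - lam i) \<cdot>\<^sub>v h i"
    using cokernel_factor[OF T ho R, of "\<lambda>i. nu i - lam i"] nu by auto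
  note Z' = mat_adjoint_carrier[OF Z(1)]
  define U where "U = T * A + Z"
  have TA: "T * A \<in> carrier_mat n d" using T A by simp
  have U: "U \<in> carrier_mat n d" using TA Z by (simp add: U_def)
  obtain G where G: "length G = n" "set G \<subseteq> carrier_vec d" "analysis_op d G = U"
    using analysis_op_surj[OF U] by blast
  have "mat_adjoint Z * T = 0\<^sub>m d d"
    using mat_adjoint_mult[OF T' Z(1)] Z(2) by (simp add: mat_adjoint_adjoint[OF T] mat_adjoint_zero)
  moreover have "mat_adjoint (T * A) * T = 1\<^sub>m d"
    using mat_adjoint_mult[OF T A(1)] A assoc_mult_mat[OF A(1) T' T] by simp
  ultimately have dual: "mat_adjoint U * T = 1\<^sub>m d"
    using mat_adjoint_add[OF TA Z(1)] add_mult_distrib_mat[OF mat_adjoint_carrier[OF TA] Z' T]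
    by (simp add: U_def)
  have "W + Z - W = Z" if "W \<in> carrier_mat n d" for W using that Z(1) by (intro eq_matI) auto
  from this[OF TA] have "U - T * A = Z" by (simp only: U_def)
  then have S: "frame_op d G = A + mat_adjoint Z * Z"
    using dual_gram[OF F U, folded T_def A_def, OF dual] by (simp add: frame_op_def G(3))
  have Sc: "frame_op d G \<in> carrier_mat d d" using A(1) Z Z' by (simp add: S)
  have "frame_op d G *\<^sub>v h i = complex_of_real (nu i) \<cdot>\<^sub>v h i" if i: "i \<in> {1..d}" for i
  proof -
    have "frame_op d G *\<^sub>v h i = A *\<^sub>v h i + (mat_adjoint Z * Z) *\<^sub>v h i"
      unfolding S by (rule add_mult_distrib_mat_vec[OF A(1) mult_carrier_mat[OF Z' Z(1)] onbD(1)[OF ho i]])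
    also have "\<dots> = complex_of_real (lam i) \<cdot>\<^sub>v h i + complex_of_real (nu i - lam i) \<cdot>\<^sub>v h i"
      using h i Zh[OF i] by (simp add: eigen_onb_iff A_def)
    also have "\<dots> = (complex_of_real (lam i) + complex_of_real (nu i - lam i)) \<cdot>\<^sub>v h i"
      by (rule add_smult_distrib_vec[symmetric])
    finally show ?thesis by simp
  qed
  then have ev: "eigen_onb d (frame_op d G) nu h" using ho by (simp add: eigen_onb_iff)
  have "G \<in> frames n d"
    using frame_if_left_inverse[OF G(1,2) T] dual by (simp add: G(3))
  moreover have "t \<le> Re (mat_trace (frame_op d G))"
    using t unfolding trace_eigen[OF ev Sc] by simp
  ultimately have "G \<in> duals n d t F" using dual by (simp add: duals_def G(3) T_def)
  then show ?thesis using that ev by blast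
qed

theorem theorem4p12:
  fixes n d :: nat and F :: "complex vec list" and m :: int
    and lam :: "nat \<Rightarrow> real" and t :: real and f :: "real \<Rightarrow> real"
  assumes d_pos: "1 \<le> d"
    and n_gt_d: "n > d"
    and F_frame: "F \<in> frames n d"
    and m_def: "m = 2 * int d - int n"
    and lam_def: "lam = eigval (frame_op_inv d F)"
    and t_ge: "t \<ge> Re (mat_trace (frame_op_inv d F))"
    and f_nonneg: "\<And>x. 0 \<le> x \<Longrightarrow> 0 \<le> f x"
    and f_incr: "mono_on {0..} f"
    and f_strict_convex: "\<And>x y u. \<lbrakk>0 \<le> x; 0 \<le> y; x \<noteq> y; 0 < u; u < 1\<rbrakk>
      \<Longrightarrow> f ((1 - u) * x + u * y) < (1 - u) * f x + u * f y"
  shows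
    "(\<forall>G. is_arg_min (frame_potential d f) (\<lambda>G'. G' \<in> duals n d t F) G \<longrightarrow>
        (\<exists>h. eigen_onb d (frame_op_inv d F) lam h \<and>
          (let r' = nat (max (int (r_lam_m d lam m t)) m) in
            frame_op d G = frame_op_inv d F +
              mat_sum d (\<lambda>i. complex_of_real (c_lam_m d lam m t - lam (r' + i))
                \<cdot>\<^sub>m outer (h (r' + i)) (h (r' + i))) {1..d - r'})))
     \<and>
     (m \<le> 0
      \<or> (m \<ge> 1 \<and> lam (nat m) > lam (nat m + 1))
      \<or> (m \<ge> 1 \<and> lam (nat m) = lam (nat m + 1) \<and> t \<le> s_star d lam (nat m))
      \<longrightarrow>
      (\<exists>!S. S \<in> dual_frame_ops n d t F \<and>
        (\<forall>G. is_arg_min (frame_potential d f) (\<lambda>G'. G' \<in> duals n d t F) G \<longrightarrow>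
          frame_op d G = S)))"
proof -
  define A where "A = frame_op_inv d F"
  define c where "c = c_lam_m d lam m t"
  define R where "R = nat (max (int (r_lam_m d lam m t)) m)"
  note A = frame_op_inv_props(1,4)[OF F_frame, folded A_def]
  obtain g where g: "eigen_onb d A lam g"
    using hermitian_eigen_onb[OF A] by (auto simp: lam_def A_def)
  have lam_pos: "0 < lam i" if i: "i \<in> {1..d}" for i
  proof (rule frame_op_inv_eigenvalue_pos[OF F_frame, of "g i"])
    have gi: "g i \<in> carrier_vec d" "g i \<bullet>c g i = 1" using g i by (auto simp: eigen_onb_def)
    then show "g i \<in> carrier_vec d" "g i \<noteq> 0\<^sub>v d" using cscalar_self_eq_0[OF gi(1)] by auto
    show "frame_op_inv d F *\<^sub>v g i = complex_of_real (lam i) \<cdot>\<^sub>v g i"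
      using g i by (simp add: eigen_onb_def A_def)
  qed
  have lam_dec: "lam j \<le> lam i" if "1 \<le> i" "i \<le> j" "j \<le> d" for i j
    using eigval_antimono[OF A that] by (simp add: lam_def A_def)
  have t: "(\<Sum>i=1..d. lam i) \<le> t"
    using t_ge trace_eigen[OF g A(1)] by (simp add: A_def)
  have "m < int d" using m_def n_gt_d by simp
  from water_filling_level[OF d_pos t lam_pos lam_dec this, folded c_def R_def]
  obtain M where M: "M = 0 \<or> 0 < m \<and> M = nat m \<and> s_star d lam (nat m) < t" and c: "0 < c"
    and R: "R < d" "m \<le> int R"
    and fill: "\<And>i. i \<in> {1..R} \<Longrightarrow> (if i \<le> M \<and> lam i < c then lam i else max (lam i) c) = lam i"
      "\<And>i. i \<in> {R<..d} \<Longrightarrow> (if i \<le> M \<and> lam i < c then lam i else max (lam i) c) = c"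
      "(\<Sum>i=1..d. if i \<le> M \<and> lam i < c then lam i else max (lam i) c) = t"
    by blast
  define nu where "nu i = (if i \<le> M \<and> lam i < c then lam i else max (lam i) c)" for i
  note fill = fill[folded nu_def]
  have f: "strictly_convex f" using f_strict_convex by (auto simp: strictly_convex_def)

  \<comment> \<open>The hypothesis is a bound on the potential rather than minimality, so that it
    serves both to describe minimizers and to prove that \<open>G0\<close> is one.\<close>
  have optimal: "\<exists>h. eigen_onb d A lam h \<and> eigen_onb d (frame_op d G) nu h"
    if G: "G \<in> duals n d t F" and le: "frame_potential d f G \<le> (\<Sum>i=1..d. f (nu i))" for G
  proof -
    have lG: "length G = n" and dual: "mat_adjoint (analysis_op d G) * analysis_op d F = 1\<^sub>m d"
      using G by (auto simp: duals_def frames_def)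
    note U = analysis_op_carrier[OF lG, of d]
    have "length F = n" using F_frame by (simp add: frames_def)
    then have T: "analysis_op d F \<in> carrier_mat n d" by (rule analysis_op_carrier)
    let ?Z = "analysis_op d G - analysis_op d F * A"
    have Z: "?Z \<in> carrier_mat n d" using T A by auto
    obtain e where e: "eigen_onb d (frame_op d G) (eigval (frame_op d G)) e"
      using hermitian_eigen_onb[OF duals_gram(1,2)[OF G]] by blast
    \<comment> \<open>Vacuous if \<open>M = 0\<close>; otherwise \<open>M = 2 * d - n\<close>, which
      is the count required by the kernel lemma.\<close>
    have ker: "\<exists>u\<in>carrier_vec d. u \<bullet>c u = 1 \<and> ?Z *\<^sub>v u = 0\<^sub>v n \<and> (\<forall>w\<in>set ws. u \<bullet>c w = 0)"
      if "set ws \<subseteq> carrier_vec d" "length ws < M" for ws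
      using M m_def that dual_kernel[OF F_frame U dual that(1)] by (auto simp: A_def)
    have Md: "M \<le> d" using M m_def n_gt_d by auto
    have S: "frame_op d G = A + mat_adjoint ?Z * ?Z"
      using dual_gram[OF F_frame U dual] by (simp add: frame_op_def A_def)
    have tr: "(\<Sum>i=1..d. nu i) \<le> (\<Sum>i=1..d. eigval (frame_op d G) i)"
      using fill(3) duals_gram(3)[OF G e] by simp
    have le': "(\<Sum>i=1..d. f (eigval (frame_op d G) i)) \<le> (\<Sum>i=1..d. f (nu i))"
      using le duals_gram(4)[OF G e] by simp
    obtain h where "eigen_onb d A lam h" "eigen_onb d (frame_op d G) nu h"
      using optimal_perturbation[OF A Z g lam_pos lam_dec Md ker S e f f_incr c nu_def tr le'] by blast
    then show ?thesis by blast
  qed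

  have nu_ge: "lam i \<le> nu i" for i by (auto simp: nu_def)
  have "2 * d \<le> n + R" using R(2) m_def by simp
  then obtain G0 where G0: "G0 \<in> duals n d t F" "eigen_onb d (frame_op d G0) nu g"
    using dual_with_spectrum[OF F_frame g[unfolded A_def] less_imp_le[OF R(1)], of nu t] nu_ge fill(1,3)
    by auto
  have P0: "frame_potential d f G0 = (\<Sum>i=1..d. f (nu i))"
    by (rule duals_gram(4)[OF G0])
  have argmin: "\<exists>h. eigen_onb d A lam h \<and> eigen_onb d (frame_op d G) nu h"
    if "is_arg_min (frame_potential d f) (\<lambda>G'. G' \<in> duals n d t F) G" for G
    using that G0(1) P0 by (intro optimal) (auto simp: is_arg_min_def not_less)
  have G0_min: "is_arg_min (frame_potential d f) (\<lambda>G'. G' \<in> duals n d t F) G0"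
    unfolding is_arg_min_def
  proof (intro conjI notI)
    assume "\<exists>y. y \<in> duals n d t F \<and> frame_potential d f y < frame_potential d f G0"
    then obtain G where G: "G \<in> duals n d t F" "frame_potential d f G < (\<Sum>i=1..d. f (nu i))"
      using P0 by auto
    \<comment> \<open>A strictly better dual would also have spectrum \<open>nu\<close>, hence the
      same potential as \<open>G0\<close>.\<close>
    then obtain h where "eigen_onb d (frame_op d G) nu h" using optimal[OF G(1)] by auto
    then show False using duals_gram(4)[OF G(1)] G(2) by auto
  qed (rule G0(1))

  show ?thesis
  proof (intro conjI allI impI)
    fix G assume G: "is_arg_min (frame_potential d f) (\<lambda>G'. G' \<in> duals n d t F) G"
    obtain h where h: "eigen_onb d A lam h" "eigen_onb d (frame_op d G) nu h" using argmin[OF G] by blast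
    have "G \<in> duals n d t F" using G by (simp add: is_arg_min_def)
    from eigen_onb_difference[OF A(1) h(1) duals_gram(1)[OF this] h(2) fill(1,2)] h(1)
    show "\<exists>h. eigen_onb d (frame_op_inv d F) lam h \<and>
          (let r' = nat (max (int (r_lam_m d lam m t)) m) in
            frame_op d G = frame_op_inv d F +
              mat_sum d (\<lambda>i. complex_of_real (c_lam_m d lam m t - lam (r' + i))
                \<cdot>\<^sub>m outer (h (r' + i)) (h (r' + i))) {1..d - r'})"
      unfolding Let_def R_def[symmetric] c_def[symmetric] A_def[symmetric] by blast
  next
    assume cond: "m \<le> 0 \<or> (m \<ge> 1 \<and> lam (nat m) > lam (nat m + 1))
      \<or> (m \<ge> 1 \<and> lam (nat m) = lam (nat m + 1) \<and> t \<le> s_star d lam (nat m))"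
    \<comment> \<open>Once \<open>nu\<close> depends on \<open>lam i\<close> alone, every minimizer
      has frame operator \<open>\<psi>(A)\<close>, whatever its eigenbasis.\<close>
    obtain \<psi> where \<psi>: "\<And>i. i \<in> {1..d} \<Longrightarrow> nu i = \<psi> (lam i)"
    proof (cases "M = 0")
      case True
      then show thesis by (intro that[of "\<lambda>x. max x c"]) (auto simp: nu_def)
    next
      case False
      \<comment> \<open>An active constraint means \<open>t > s_star\<close>, so of the three
        conditions only the strict gap at \<open>m\<close> remains. It lets \<open>i <= M\<close> be
        read off from the value \<open>lam i\<close>.\<close>
      then have M: "0 < m" "M = nat m" and gap: "lam (M + 1) < lam M" using M cond by auto
      show thesis
      proof (rule that[of "\<lambda>x. if lam M \<le> x \<and> x < c then x else max x c"])
        fix i assume i: "i \<in> {1..d}"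
        have "i \<le> M \<longleftrightarrow> lam M \<le> lam i"
          using lam_dec[of i M] lam_dec[of "M + 1" i] i gap M \<open>m < int d\<close>
          by (cases "i \<le> M") auto
        then show "nu i = (if lam M \<le> lam i \<and> lam i < c then lam i else max (lam i) c)"
          by (simp add: nu_def)
      qed
    qed
    have eq: "frame_op d G = spectral_sum d (\<lambda>i. \<psi> (lam i)) g {1..d}"
      if G: "is_arg_min (frame_potential d f) (\<lambda>G'. G' \<in> duals n d t F) G" for G
    proof -
      obtain h where h: "eigen_onb d A lam h" "eigen_onb d (frame_op d G) nu h" using argmin[OF G] by blast
      then have "eigen_onb d (frame_op d G) (\<lambda>i. \<psi> (lam i)) h" using \<psi> by (simp add: eigen_onb_iff)
      moreover have "frame_op d G \<in> carrier_mat d d"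
        using G duals_gram(1) by (auto simp: is_arg_min_def)
      ultimately have "frame_op d G = spectral_sum d (\<lambda>i. \<psi> (lam i)) h {1..d}"
        by (rule eigen_decomposition)
      then show ?thesis using spectral_sum_unique[OF h(1) g A(1), of \<psi>] by simp
    qed
    show "\<exists>!S. S \<in> dual_frame_ops n d t F \<and>
        (\<forall>G. is_arg_min (frame_potential d f) (\<lambda>G'. G' \<in> duals n d t F) G \<longrightarrow> frame_op d G = S)"
    proof (rule ex1I[of _ "frame_op d G0"])
      have "frame_op d G0 \<in> dual_frame_ops n d t F"
        unfolding dual_frame_ops_def by (rule imageI[OF G0(1)])
      then show "frame_op d G0 \<in> dual_frame_ops n d t F \<and>
        (\<forall>G. is_arg_min (frame_potential d f) (\<lambda>G'. G' \<in> duals n d t F) G \<longrightarrow> frame_op d G = frame_op d G0)"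
        using eq eq[OF G0_min] by simp
    \<comment> \<open>Any other candidate must agree with the frame operator of the minimizer
      \<open>G0\<close>; the existence of a minimizer keeps the condition from being
      vacuous.\<close>
    qed (use G0_min in blast)
  qed
qed

end
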